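(* Let $F:\mathbb{R}^d\to\mathbb{R}$ be convex, differentiable with $L$-Lipschitz continuous gradient ($L>0$), and $\lambda$-strongly convex for some $\lambda\ge 0$ ($\lambda=0$ permitted). Let $\mathcal{H}:\mathcal{P}_2(\mathbb{R}^d)\to\mathbb{R}\cup\{+\infty\}$ be proper, lower semicontinuous (with respect to $W_2$) and convex along generalized geodesics, with $\operatorname{dom}(\mathcal{H})\subset\mathcal{P}_2^r(\mathbb{R}^d)$. Let $\mathcal{G}(\mu)=\int F\,d\mu+\mathcal{H}(\mu)$. Let $0<\tau<\frac1L$ and $S_\tau(\mu):=J_{\tau,\mathcal{H}}\big((I-\tau\nabla F)_{\#}\mu\big)$. Then $$W_2^2(S_\tau(\mu), \nu)\leq (1-\tau \lambda)W_2^2(\mu,\nu)-2\tau \big(\mathcal{G}(S_\tau(\mu))-\mathcal{G}(\nu)\big)-(1-\tau L)W_2^2(\mu,S_\tau(\mu))$$ for all $\mu,\nu \in \mathcal{P}_2(\mathbb{R}^d)$.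
   Context: $\mathcal{P}_2(\mathbb{R}^d)$ is the set of Borel probability measures on $\mathbb{R}^d$ with finite second moment; $\mathcal{P}_2^r(\mathbb{R}^d)$ is the subset of those absolutely continuous with respect to Lebesgue measure. $W_2$ is the 2-Wasserstein distance for the Euclidean cost; $\Gamma_{\rm opt}(\mu,\nu)$ is the set of optimal couplings. $I$ is the identity map and $T_{\#}\mu$ the pushforward of $\mu$ by $T$. $\operatorname{dom}(\mathcal{H})=\{\mu:\mathcal{H}(\mu)<+\infty\}$. A generalized geodesic between $\mu_0,\mu_1\in\mathcal{P}_2(\mathbb{R}^d)$ with base $\nu\in\mathcal{P}_2(\mathbb{R}^d)$ is a curve $\mu_t=((1-t)\pi^2+t\pi^3)_{\#}\gamma$, $t\in[0,1]$, where $\gamma$ is a probability measure on $(\mathbb{R}^d)^3$ with marginals $\nu,\mu_0,\mu_1$ such that $\pi^{1,2}_{\#}\gamma\in\Gamma_{\rm opt}(\nu,\mu_0)$ and $\pi^{1,3}_{\#}\gamma\in\Gamma_{\rm opt}(\nu,\mu_1)$ ($\pi^i$, $\pi^{i,j}$ are the coordinate projections). A proper function $\mathcal{H}$ is convex along generalized geodesics if for every $\mu_0,\mu_1,\nu\in\mathcal{P}_2(\mathbb{R}^d)$ there is a generalized geodesic $(\mu_s)_{s\in[0,1]}$ between $\mu_0$ and $\mu_1$ with base $\nu$ such that $\mathcal{H}(\mu_s)\le(1-s)\mathcal{H}(\mu_0)+s\,\mathcal{H}(\mu_1)$ for all $s\in[0,1]$. For $\tau>0$, $J_{\tau,\mathcal{H}}(\mu)$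 is the (unique) minimizer of $\nu\mapsto \mathcal{H}(\nu)+\frac{1}{2\tau}W_2^2(\nu,\mu)$ over $\mathcal{P}_2(\mathbb{R}^d)$. The inequality is trivially true when $\mathcal{G}(\nu)=+\infty$. *)

theory Defs
  imports "HOL-Probability.Probability"
begin

section \<open>Wasserstein space over a Euclidean space\<close>

definition P2 :: "'a::euclidean_space measure set" where
  "P2 = {\<mu>. prob_space \<mu> \<and> sets \<mu> = sets borel \<and> integrable \<mu> (\<lambda>x. (norm x)\<^sup>2)}"

definition P2_ac :: "'a::euclidean_space measure set" where
  "P2_ac = {\<mu> \<in> P2. absolutely_continuous lborel \<mu>}"

definition couplings ::
  "'a::euclidean_space measure \<Rightarrow> 'a measure \<Rightarrow> ('a \<times> 'a) measure set" where
  "couplings \<mu> \<nu> = {\<gamma>. prob_space \<gamma> \<and> sets \<gamma> = sets borel \<and>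
     distr \<gamma> borel fst = \<mu> \<and> distr \<gamma> borel snd = \<nu>}"

definition transport_cost :: "('a::euclidean_space \<times> 'a) measure \<Rightarrow> ennreal" where
  "transport_cost \<gamma> = (\<integral>\<^sup>+ z. ennreal ((norm (fst z - snd z))\<^sup>2) \<partial>\<gamma>)"

definition opt_couplings ::
  "'a::euclidean_space measure \<Rightarrow> 'a measure \<Rightarrow> ('a \<times> 'a) measure set" where
  "opt_couplings \<mu> \<nu> = {\<gamma> \<in> couplings \<mu> \<nu>.
     transport_cost \<gamma> = (INF \<gamma>'\<in>couplings \<mu> \<nu>. transport_cost \<gamma>')}"

text \<open>The infimum is finite on \<open>P2\<close>, which is the only place where \<open>W2\<close> is used.\<close>

definition W2 :: "'a::euclidean_space measure \<Rightarrow> 'a measure \<Rightarrow> real" where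
  "W2 \<mu> \<nu> = sqrt (enn2real (INF \<gamma>\<in>couplings \<mu> \<nu>. transport_cost \<gamma>))"

section \<open>Functionals on the Wasserstein space\<close>

text \<open>
  A functional on \<open>P2\<close> is a function on all measures of which only the values on \<open>P2\<close> matter.
  Its values lie in the reals together with \<open>\<infinity>\<close>, so the value \<open>-\<infinity>\<close> is ruled out in \<open>proper_P2\<close>.
\<close>

definition dom_P2 :: "('a::euclidean_space measure \<Rightarrow> ereal) \<Rightarrow> 'a measure set" where
  "dom_P2 H = {\<mu> \<in> P2. H \<mu> < \<infinity>}"

definition proper_P2 :: "('a::euclidean_space measure \<Rightarrow> ereal) \<Rightarrow> bool" where
  "proper_P2 H \<longleftrightarrow> (\<forall>\<mu>\<in>P2. H \<mu> \<noteq> -\<infinity>) \<and> dom_P2 H \<noteq> {}"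

definition lsc_W2 :: "('a::euclidean_space measure \<Rightarrow> ereal) \<Rightarrow> bool" where
  "lsc_W2 H \<longleftrightarrow> (\<forall>\<mu>\<in>P2. \<forall>c. c < H \<mu> \<longrightarrow>
     (\<exists>\<delta>>0. \<forall>\<nu>\<in>P2. W2 \<mu> \<nu> < \<delta> \<longrightarrow> c < H \<nu>))"

definition generalized_geodesic ::
  "'a::euclidean_space measure \<Rightarrow> 'a measure \<Rightarrow> 'a measure \<Rightarrow> (real \<Rightarrow> 'a measure) \<Rightarrow> bool" where
  "generalized_geodesic \<nu> \<mu>0 \<mu>1 m \<longleftrightarrow>
     (\<exists>\<gamma> :: ('a \<times> 'a \<times> 'a) measure.
        prob_space \<gamma> \<and> sets \<gamma> = sets borel \<and>
        distr \<gamma> borel (\<lambda>(x, y, z). x) = \<nu> \<and>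
        distr \<gamma> borel (\<lambda>(x, y, z). y) = \<mu>0 \<and>
        distr \<gamma> borel (\<lambda>(x, y, z). z) = \<mu>1 \<and>
        distr \<gamma> borel (\<lambda>(x, y, z). (x, y)) \<in> opt_couplings \<nu> \<mu>0 \<and>
        distr \<gamma> borel (\<lambda>(x, y, z). (x, z)) \<in> opt_couplings \<nu> \<mu>1 \<and>
        (\<forall>t\<in>{0..1}. m t = distr \<gamma> borel (\<lambda>(x, y, z). (1 - t) *\<^sub>R y + t *\<^sub>R z)))"

text \<open>
  In \<open>ereal\<close> we have \<open>0 * \<infinity> = 0\<close>; at the endpoints \<open>s = 0\<close> and \<open>s = 1\<close> the inequality below is an
  equality, since the curve starts at \<open>\<mu>0\<close> and ends at \<open>\<mu>1\<close>.
\<close>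

definition convex_along_gen_geodesics :: "('a::euclidean_space measure \<Rightarrow> ereal) \<Rightarrow> bool" where
  "convex_along_gen_geodesics H \<longleftrightarrow>
     (\<forall>\<mu>0\<in>P2. \<forall>\<mu>1\<in>P2. \<forall>\<nu>\<in>P2. \<exists>m. generalized_geodesic \<nu> \<mu>0 \<mu>1 m \<and>
        (\<forall>s\<in>{0..1}. H (m s) \<le> ereal (1 - s) * H \<mu>0 + ereal s * H \<mu>1))"

section \<open>The forward-backward scheme\<close>

text \<open>
  The resolvent \<open>J\<close> of \<open>H\<close> with step \<open>\<tau>\<close>. For \<open>\<tau> > 0\<close> and \<open>H\<close> proper, lower semicontinuous and convex
  along generalized geodesics, the minimizer exists and is unique; otherwise the value is
  unspecified.
\<close>

definition prox_W2 :: "real \<Rightarrow> ('a::euclidean_space measure \<Rightarrow> ereal) \<Rightarrow> 'a measure \<Rightarrow> 'a measure" where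
  "prox_W2 \<tau> H \<mu> = arg_min_on (\<lambda>\<nu>. H \<nu> + ereal (1 / (2 * \<tau>) * (W2 \<nu> \<mu>)\<^sup>2)) P2"

definition fb_step :: "real \<Rightarrow> ('a::euclidean_space \<Rightarrow> 'a) \<Rightarrow> ('a measure \<Rightarrow> ereal) \<Rightarrow>
    'a measure \<Rightarrow> 'a measure" where
  "fb_step \<tau> gradF H \<mu> = prox_W2 \<tau> H (distr \<mu> borel (\<lambda>x. x - \<tau> *\<^sub>R gradF x))"

definition energy :: "('a::euclidean_space \<Rightarrow> real) \<Rightarrow> ('a measure \<Rightarrow> ereal) \<Rightarrow> 'a measure \<Rightarrow> ereal" where
  "energy F H \<mu> = ereal (\<integral>x. F x \<partial>\<mu>) + H \<mu>"

definition strongly_convex :: "real \<Rightarrow> ('a::euclidean_space \<Rightarrow> real) \<Rightarrow> bool" where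
  "strongly_convex lam F \<longleftrightarrow> (\<forall>x y. \<forall>t\<in>{0..1}.
     F ((1 - t) *\<^sub>R x + t *\<^sub>R y) \<le>
       (1 - t) * F x + t * F y - lam / 2 * t * (1 - t) * (norm (x - y))\<^sup>2)"

end

theory Submission
  imports Defs
begin

text \<open>
  Put \<open>T x = x - \<tau> *\<^sub>R gradF x\<close>, \<open>\<rho>\<close> for the image of \<open>\<mu>\<close> under \<open>T\<close>, and \<open>J\<close> for the minimizer of
  \<open>H + (W2 \<sqdot> \<rho>)\<^sup>2 / (2 * \<tau>)\<close>. Comparing \<open>J\<close> with points near it on a generalized geodesic from \<open>J\<close> to \<open>\<nu>\<close>
  with base \<open>\<rho>\<close> gives
  \<open>(W2 J \<nu>)\<^sup>2 \<le> (W2 \<rho> \<nu>)\<^sup>2 - (W2 \<rho> J)\<^sup>2 - 2 * \<tau> * (H J - H \<nu>)\<close>.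
  Pushing an optimal plan between \<open>\<mu>\<close> and \<open>\<nu>\<close> forward by \<open>T\<close> bounds \<open>W2 \<rho> \<nu>\<close> from above by strong convexity
  of \<open>F\<close>. Pulling an optimal plan between \<open>\<rho>\<close> and \<open>J\<close> back by \<open>T\<close>, which is a bijection with Lipschitz
  inverse because \<open>\<tau> * L < 1\<close>, bounds \<open>W2 \<rho> J\<close> from below by \<open>L\<close>-smoothness of \<open>F\<close>. No optimal maps are
  needed.

  That the minimizer exists has to be shown as well. The three-plans supplied by convexity along generalized
  geodesics already contain optimal couplings and glue them, which yields the triangle inequality for \<open>W2\<close>.
  Convexity at the midpoint makes every fast minimizing sequence Cauchy, and completeness of \<open>W2\<close> and lower
  semicontinuity give the minimizer.
\<close>

section \<open>Markov chains with prescribed two-step marginals\<close>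

text \<open>Conditioning \<open>p n\<close> on its first coordinate gives a transition kernel from
  time \<open>n\<close> to time \<open>n + 1\<close>, and the Ionescu-Tulcea theorem turns the
  kernels into a law on sequences. Consistency makes the state reached by one kernel distributed as
  the next one expects.\<close>

lemma markov_sequence:
  fixes p :: "nat \<Rightarrow> ('a::countable \<times> 'a) pmf"
  assumes consistent: "\<And>n. map_pmf snd (p n) = map_pmf fst (p (Suc n))"
  obtains M :: "(nat \<Rightarrow> 'a) measure"
  where "prob_space M" "sets M = sets (PiM UNIV (\<lambda>_. count_space UNIV))"
    "\<And>n f. (\<integral>\<^sup>+\<omega>. f (\<omega> n, \<omega> (Suc n)) \<partial>M) = (\<integral>\<^sup>+z. f z \<partial>measure_pmf (p n))"
proof -
  define N :: "nat \<Rightarrow> 'a measure" where "N = (\<lambda>_. count_space UNIV)"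
  \<comment> \<open>If \<open>i\<close> lies outside the support of the first marginal, the
    conditional pmf is arbitrary; such \<open>i\<close> have mass zero.\<close>
  define k where "k n i = map_pmf snd (cond_pmf (p n) {z. fst z = i})" for n i
  \<comment> \<open>Time 0 ignores the history and draws the initial state; every later kernel looks
    only at the last state.\<close>
  define K where "K n \<omega> = (case n of 0 \<Rightarrow> map_pmf fst (p 0) | Suc n \<Rightarrow> k n (\<omega> n))" for n \<omega>
  have K_meas: "(\<lambda>\<omega>. measure_pmf (K n \<omega>)) \<in> measurable (PiM {0..<n} N) (subprob_algebra (N n))" for n
  proof (cases n)
    case 0
    then show ?thesis
      by (simp add: K_def N_def measure_subprob)
  next
    case (Suc m)
    have 1: "(\<lambda>\<omega>. \<omega> m) \<in> measurable (PiM {0..<n} N) (count_space UNIV)"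
      using measurable_component_singleton[of m "{0..<n}" N] Suc by (simp add: N_def)
    have 2: "(\<lambda>i. measure_pmf (k m i)) \<in> measurable (count_space UNIV) (subprob_algebra (N n))"
      by (simp add: N_def measure_subprob)
    show ?thesis
      using measurable_compose[OF 1 2] by (simp add: K_def Suc)
  qed
  interpret Ionescu_Tulcea "\<lambda>n \<omega>. measure_pmf (K n \<omega>)" N
    by unfold_locales (auto simp: K_meas measure_pmf.prob_space_axioms intro: prob_space.emeasure_space_1 measure_pmf.prob_space_axioms)
  \<comment> \<open>The empty history, which is the only point of the product over no
    indices.\<close>
  define u where "u = (\<lambda>_::nat. undefined :: 'a)"
  have u: "u \<in> space (PiM {0..<0} N)"
    by (simp add: u_def space_PiM)
  have coord: "(\<lambda>\<omega>. \<omega> m) \<in> measurable (PiM {0..<n} N) (count_space UNIV)" if "m < n" for m n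
    using measurable_component_singleton[of m "{0..<n}" N] that by (simp add: N_def)
  have pair: "(\<lambda>\<omega>. f (\<omega> m, \<omega> (Suc m))) \<in> borel_measurable (PiM J N)" if "{m, Suc m} \<subseteq> J" for f :: "_ \<Rightarrow> ennreal" and m J
  proof -
    have c: "(\<lambda>\<omega>. \<omega> i) \<in> measurable (PiM J N) (count_space UNIV)" if "i \<in> J" for i
      using measurable_component_singleton[of i J N] that by (simp add: N_def)
    have "(\<lambda>\<omega>. (\<omega> m, \<omega> (Suc m))) \<in> measurable (PiM J N) (count_space UNIV)"
      using measurable_Pair[OF c[of m] c[of "Suc m"]] that
      by (simp add: pair_measure_countable)
    then show ?thesis
      by (rule measurable_compose) simp
  qed
  \<comment> \<open>Disintegration of \<open>p n\<close> into its first marginal and the kernel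
    \<open>k n\<close>.\<close>
  have disint: "(\<integral>\<^sup>+i. (\<integral>\<^sup>+j. f (i, j) \<partial>k n i) \<partial>map_pmf fst (p n)) = (\<integral>\<^sup>+z. f z \<partial>p n)" for n and f :: "_ \<Rightarrow> ennreal"
  proof -
    have "bind_pmf (map_pmf fst (p n)) (\<lambda>i. cond_pmf (p n) {z. i = fst z}) = p n"
    proof (rule bind_cond_pmf_cancel)
      fix x y assume "x \<in> set_pmf (map_pmf fst (p n))" "y \<in> set_pmf (p n)" "x = fst y"
      then show "measure (p n) {y. x = fst y} = measure (map_pmf fst (p n)) {x. x = fst y}"
        by (auto simp: vimage_def intro!: arg_cong[where f="measure _"])
    qed auto
    then have "(\<integral>\<^sup>+z. f z \<partial>p n) = (\<integral>\<^sup>+z. f z \<partial>bind_pmf (map_pmf fst (p n)) (\<lambda>i. cond_pmf (p n) {z. fst z = i}))"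
      by (simp add: eq_commute)
    also have "\<dots> = (\<integral>\<^sup>+i. \<integral>\<^sup>+z. f z \<partial>cond_pmf (p n) {z. fst z = i} \<partial>map_pmf fst (p n))"
      by (simp add: measure_pmf_bind nn_integral_bind[where B="count_space UNIV"] measure_subprob)
    also have "\<dots> = (\<integral>\<^sup>+i. (\<integral>\<^sup>+j. f (i, j) \<partial>k n i) \<partial>map_pmf fst (p n))"
    proof (intro nn_integral_cong_AE, unfold AE_measure_pmf_iff, intro ballI)
      fix i assume "i \<in> set_pmf (map_pmf fst (p n))"
      then have "set_pmf (p n) \<inter> {z. fst z = i} \<noteq> {}"
        by auto
      then have "\<forall>z\<in>set_pmf (cond_pmf (p n) {z. fst z = i}). f z = f (i, snd z)"
        by auto
      then show "(\<integral>\<^sup>+z. f z \<partial>cond_pmf (p n) {z. fst z = i}) = (\<integral>\<^sup>+j. f (i, j) \<partial>k n i)"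
        unfolding k_def nn_integral_map_pmf
        by (intro nn_integral_cong_AE) (simp add: AE_measure_pmf_iff)
    qed
    finally show ?thesis ..
  qed
  \<comment> \<open>\<open>C 0 n u\<close> is the law of the coordinates below \<open>n\<close>, so
    coordinate \<open>n\<close> first appears in \<open>C 0 (Suc n) u\<close>.\<close>
  have C_Suc: "(\<integral>\<^sup>+\<omega>. g \<omega> \<partial>C 0 (Suc n) u) = (\<integral>\<^sup>+\<omega>. \<integral>\<^sup>+x. g (fun_upd \<omega> n x) \<partial>K n \<omega> \<partial>C 0 n u)"
    if g: "g \<in> borel_measurable (PiM {0..<Suc n} N)" for g n
  proof -
    have "(\<integral>\<^sup>+\<omega>. g \<omega> \<partial>C 0 (Suc n) u) = (\<integral>\<^sup>+\<omega>. (\<integral>\<^sup>+x. g x \<partial>eP n \<omega>) \<partial>C 0 n u)"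
      using u g measurable_eP[of n] sets_C[OF u, of n]
      by (simp, intro nn_integral_bind[where B="PiM {0..<Suc n} N"]) (simp_all cong: measurable_cong_sets)
    also have "\<dots> = (\<integral>\<^sup>+\<omega>. \<integral>\<^sup>+x. g (fun_upd \<omega> n x) \<partial>K n \<omega> \<partial>C 0 n u)"
      using u g by (intro nn_integral_cong nn_integral_eP) (auto simp: space_C)
    finally show ?thesis .
  qed
  \<comment> \<open>Stated conditionally on the law of coordinate \<open>n\<close>, so that it
    serves both inside the induction for \<open>law\<close> and after it.\<close>
  have pair_law: "(\<integral>\<^sup>+\<omega>. f (\<omega> n, \<omega> (Suc n)) \<partial>C 0 (Suc (Suc n)) u) = (\<integral>\<^sup>+z. f z \<partial>p n)"
    if *: "\<And>f. (\<integral>\<^sup>+\<omega>. f (\<omega> n) \<partial>C 0 (Suc n) u) = (\<integral>\<^sup>+z. f z \<partial>map_pmf fst (p n))"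
    for n and f :: "'a \<times> 'a \<Rightarrow> ennreal"
  proof -
    have "(\<integral>\<^sup>+\<omega>. f (\<omega> n, \<omega> (Suc n)) \<partial>C 0 (Suc (Suc n)) u) =
        (\<integral>\<^sup>+\<omega>. \<integral>\<^sup>+x. f (\<omega> n, x) \<partial>k n (\<omega> n) \<partial>C 0 (Suc n) u)"
      by (subst C_Suc) (auto intro!: pair simp: K_def)
    also have "\<dots> = (\<integral>\<^sup>+z. f z \<partial>p n)"
      by (subst *) (rule disint)
    finally show ?thesis .
  qed
  have law: "(\<integral>\<^sup>+\<omega>. f (\<omega> n) \<partial>C 0 (Suc n) u) = (\<integral>\<^sup>+z. f z \<partial>map_pmf fst (p n))" for n and f :: "'a \<Rightarrow> ennreal"
  proof (induction n arbitrary: f)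
    case 0
    have "(\<lambda>\<omega>. f (\<omega> 0)) \<in> borel_measurable (PiM {0..<Suc 0} N)"
      by (rule measurable_compose[OF coord]) auto
    from C_Suc[OF this] show ?case
      using u prob_space.emeasure_space_1[OF prob_space_C[OF u, of 0]]
      by (simp add: K_def del: C.simps)
  next
    case (Suc n)
    have "(\<integral>\<^sup>+\<omega>. f (\<omega> (Suc n)) \<partial>C 0 (Suc (Suc n)) u) = (\<integral>\<^sup>+z. f (snd z) \<partial>p n)"
      using pair_law[OF Suc.IH, of "\<lambda>z. f (snd z)"] by simp
    also have "\<dots> = (\<integral>\<^sup>+z. f z \<partial>map_pmf fst (p (Suc n)))"
      by (simp add: consistent[symmetric])
    finally show ?case .
  qed
  \<comment> \<open>The limit measure and the finite chain have the same image on the coordinates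
    \<open>n\<close> and \<open>Suc n\<close>; the shortest initial segment that contains both has
    length \<open>n + 2\<close>.\<close>
  have main: "(\<integral>\<^sup>+\<omega>. f (\<omega> n, \<omega> (Suc n)) \<partial>PF.lim) = (\<integral>\<^sup>+z. f z \<partial>p n)" for n and f :: "'a \<times> 'a \<Rightarrow> ennreal"
  proof -
    let ?J = "{n, Suc n}"
    have "up_to ?J \<le> m \<longleftrightarrow> Suc (Suc n) \<le> m" for m
      by (subst up_to_iff) auto
    then have up: "up_to ?J = Suc (Suc n)"
      by (meson order_antisym order_refl)
    have r: "(\<lambda>\<omega>. restrict \<omega> ?J) \<in> measurable PF.lim (PiM ?J N)"
      by (simp add: measurable_cong_sets[OF PF.sets_lim refl] measurable_restrict_subset)
    have r': "(\<lambda>\<omega>. restrict \<omega> ?J) \<in> measurable (C 0 (Suc (Suc n)) u) (PiM ?J N)"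
      by (subst measurable_cong_sets[OF sets_C[OF u] refl]) (auto intro!: measurable_restrict_subset)
    have "(\<integral>\<^sup>+\<omega>. f (\<omega> n, \<omega> (Suc n)) \<partial>PF.lim) = (\<integral>\<^sup>+\<omega>. f (\<omega> n, \<omega> (Suc n)) \<partial>distr PF.lim (PiM ?J N) (\<lambda>\<omega>. restrict \<omega> ?J))"
      by (subst nn_integral_distr[OF r]) (simp_all add: pair)
    also have "\<dots> = (\<integral>\<^sup>+\<omega>. f (\<omega> n, \<omega> (Suc n)) \<partial>distr (C 0 (Suc (Suc n)) u) (PiM ?J N) (\<lambda>\<omega>. restrict \<omega> ?J))"
      by (simp add: distr_lim CI_def up u_def del: C.simps)
    also have "\<dots> = (\<integral>\<^sup>+\<omega>. f (\<omega> n, \<omega> (Suc n)) \<partial>C 0 (Suc (Suc n)) u)"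
      by (subst nn_integral_distr[OF r']) (simp_all add: pair del: C.simps)
    also have "\<dots> = (\<integral>\<^sup>+z. f z \<partial>p n)"
      by (rule pair_law[OF law])
    finally show ?thesis .
  qed
  have "prob_space PF.lim"
    using main[of "\<lambda>_. 1" 0] by (intro prob_spaceI) (simp add: measure_pmf.emeasure_space_1)
  moreover have "sets PF.lim = sets (PiM UNIV (\<lambda>_. count_space UNIV))"
    using PF.sets_lim unfolding N_def .
  ultimately show thesis
    using that main by blast
qed

section \<open>Square-integrable functions\<close>

lemma norm_add_sq_le: "(norm (x + y))\<^sup>2 \<le> 2 * (norm x)\<^sup>2 + 2 * (norm y)\<^sup>2"
  for x y :: "'a::real_inner"
proof -
  have "0 \<le> (norm (x - y))\<^sup>2"
    by simp
  then show ?thesis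
    by (simp add: power2_norm_eq_inner inner_simps inner_commute)
qed

text \<open>Peeling off the first increment with \<open>norm_add_sq_le\<close> doubles the weight of
  all later ones. The resulting weights \<open>2 ^ Suc k\<close> are harmless for squared increments
  of order \<open>4 ^ (- k)\<close>.\<close>

lemma norm_diff_sq_le_sum:
  fixes x :: "nat \<Rightarrow> 'a::real_inner"
  shows "(norm (x n - x (n + m)))\<^sup>2 \<le> (\<Sum>k<m. 2 ^ Suc k * (norm (x (n + k) - x (Suc (n + k))))\<^sup>2)"
proof (induction m arbitrary: n)
  case (Suc m)
  have "(norm (x n - x (n + Suc m)))\<^sup>2 \<le> 2 * (norm (x n - x (Suc n)))\<^sup>2 + 2 * (norm (x (Suc n) - x (Suc n + m)))\<^sup>2"
    using norm_add_sq_le[of "x n - x (Suc n)" "x (Suc n) - x (Suc n + m)"] by simp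
  also have "\<dots> \<le> 2 * (norm (x n - x (Suc n)))\<^sup>2 +
      2 * (\<Sum>k<m. 2 ^ Suc k * (norm (x (Suc n + k) - x (Suc (Suc n + k))))\<^sup>2)"
    by (intro add_left_mono mult_left_mono Suc.IH) simp
  also have "\<dots> = (\<Sum>k<Suc m. 2 ^ Suc k * (norm (x (n + k) - x (Suc (n + k))))\<^sup>2)"
    unfolding sum.lessThan_Suc_shift by (simp add: sum_distrib_left mult.assoc)
  finally show ?case .
qed simp

text \<open>The weighted sum controls every tail with a gain of \<open>2 / 2 ^ n\<close>, which
  makes the sequence Cauchy; the bound then passes to the limit. Taking \<open>lim x\<close> itself
  keeps the limit measurable when \<open>x\<close> depends on a parameter.\<close>

lemma summable_sq_increments_imp_limit:
  fixes x :: "nat \<Rightarrow> 'a::{real_inner, banach}"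
  assumes "summable (\<lambda>k. 2 ^ k * (norm (x k - x (Suc k)))\<^sup>2)"
  shows "(norm (x n - lim x))\<^sup>2 \<le> 2 / 2 ^ n * (\<Sum>k. 2 ^ k * (norm (x k - x (Suc k)))\<^sup>2)"
proof -
  define s where "s = (\<Sum>k. 2 ^ k * (norm (x k - x (Suc k)))\<^sup>2)"
  have "s \<ge> 0"
    unfolding s_def by (intro suminf_nonneg assms) simp
  have bound: "(norm (x n - x (n + m)))\<^sup>2 \<le> 2 / 2 ^ n * s" for n m
  proof -
    have "(norm (x n - x (n + m)))\<^sup>2 \<le> (\<Sum>k<m. 2 ^ Suc k * (norm (x (n + k) - x (Suc (n + k))))\<^sup>2)"
      by (rule norm_diff_sq_le_sum)
    \<comment> \<open>Shifting the weights from \<open>k\<close> to \<open>k + n\<close> releases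
      the factor \<open>2 / 2 ^ n\<close> and leaves a block of one fixed series.\<close>
    also have "\<dots> = 2 / 2 ^ n * (\<Sum>k<m. 2 ^ (k + n) * (norm (x (k + n) - x (Suc (k + n))))\<^sup>2)"
      by (simp add: sum_distrib_left power_add add.commute field_simps)
    also have "(\<Sum>k<m. 2 ^ (k + n) * (norm (x (k + n) - x (Suc (k + n))))\<^sup>2) =
        (\<Sum>k\<in>{n..<m + n}. 2 ^ k * (norm (x k - x (Suc k)))\<^sup>2)"
      by (subst sum.shift_bounds_nat_ivl[of _ 0, simplified]) (simp add: lessThan_atLeast0)
    also have "\<dots> \<le> s"
      unfolding s_def by (intro sum_le_suminf assms) auto
    finally show ?thesis
      by (simp add: divide_right_mono)
  qed
  have "Cauchy x"
  proof (rule CauchyI')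
    fix e :: real assume "0 < e"
    have "(\<lambda>n. 2 / 2 ^ n * s) \<longlonglongrightarrow> 0"
      using LIMSEQ_divide_realpow_zero[of 2 "2 * s"] by simp
    then have "\<forall>\<^sub>F n in sequentially. 2 / 2 ^ n * s < e\<^sup>2"
      using \<open>0 < e\<close> by (intro order_tendstoD) auto
    then obtain N where N: "\<And>n. N \<le> n \<Longrightarrow> 2 / 2 ^ n * s < e\<^sup>2"
      by (auto simp: eventually_sequentially)
    show "\<exists>N. \<forall>m\<ge>N. \<forall>n>m. dist (x m) (x n) < e"
    proof (intro exI[of _ N] allI impI)
      fix m n assume "N \<le> m" "m < n"
      then have "(norm (x m - x n))\<^sup>2 < e\<^sup>2"
        using bound[of m "n - m"] N[of m] by simp
      then show "dist (x m) (x n) < e"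
        using \<open>0 < e\<close> by (simp add: dist_norm power2_less_imp_less)
    qed
  qed
  then have "x \<longlonglongrightarrow> lim x"
    by (simp add: Cauchy_convergent_iff convergent_LIMSEQ_iff)
  then have "(\<lambda>m. x (n + m)) \<longlonglongrightarrow> lim x"
    by (simp add: LIMSEQ_ignore_initial_segment add.commute[of n])
  then have "(\<lambda>m. (norm (x n - x (n + m)))\<^sup>2) \<longlonglongrightarrow> (norm (x n - lim x))\<^sup>2"
    by (intro tendsto_intros)
  then show ?thesis
    unfolding s_def[symmetric] by (rule LIMSEQ_le_const2) (use bound in auto)
qed

text \<open>The increments weighted by \<open>2 ^ k\<close> have integrals at most
  \<open>C / 2 ^ k\<close>, with total at most \<open>2 * C\<close>. Hence their sum is finite
  almost everywhere, the pointwise limit exists there, and the pointwise estimate integrates to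
  \<open>2 / 2 ^ n * (2 * C)\<close>.\<close>

lemma L2_limit_of_fast_Cauchy:
  fixes X :: "nat \<Rightarrow> 'b \<Rightarrow> 'a::euclidean_space"
  assumes X [measurable]: "\<And>n. X n \<in> borel_measurable M"
    and "C \<ge> 0"
    and bound: "\<And>n. (\<integral>\<^sup>+\<omega>. ennreal ((norm (X n \<omega> - X (Suc n) \<omega>))\<^sup>2) \<partial>M) \<le> ennreal (C / 4 ^ n)"
  obtains Y where "Y \<in> borel_measurable M"
    and "\<And>n. (\<integral>\<^sup>+\<omega>. ennreal ((norm (X n \<omega> - Y \<omega>))\<^sup>2) \<partial>M) \<le> ennreal (4 * C / 2 ^ n)"
proof
  define d where "d k \<omega> = 2 ^ k * (norm (X k \<omega> - X (Suc k) \<omega>))\<^sup>2" for k \<omega>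
  have [measurable]: "d k \<in> borel_measurable M" for k
    unfolding d_def by measurable
  define Y where "Y = (\<lambda>\<omega>. lim (\<lambda>n. X n \<omega>))"
  show [measurable]: "Y \<in> borel_measurable M"
    unfolding Y_def by measurable
  have "(\<integral>\<^sup>+\<omega>. (\<Sum>k. ennreal (d k \<omega>)) \<partial>M) = (\<Sum>k. \<integral>\<^sup>+\<omega>. ennreal (d k \<omega>) \<partial>M)"
    by (intro nn_integral_suminf) simp
  also have "\<dots> \<le> (\<Sum>k. ennreal (C * (1 / 2) ^ k))"
  proof (intro suminf_le summableI)
    fix k
    have "(\<integral>\<^sup>+\<omega>. ennreal (d k \<omega>) \<partial>M) = ennreal (2 ^ k) * (\<integral>\<^sup>+\<omega>. ennreal ((norm (X k \<omega> - X (Suc k) \<omega>))\<^sup>2) \<partial>M)"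
      unfolding d_def by (simp add: ennreal_mult nn_integral_cmult)
    also have "\<dots> \<le> ennreal (2 ^ k) * ennreal (C / 4 ^ k)"
      by (intro mult_left_mono bound) simp
    also have "\<dots> = ennreal (C * (1 / 2) ^ k)"
      using \<open>C \<ge> 0\<close> power_mult_distrib[of 2 "2::real" k]
      by (simp add: ennreal_mult[symmetric] power_one_over field_simps)
    finally show "(\<integral>\<^sup>+\<omega>. ennreal (d k \<omega>) \<partial>M) \<le> ennreal (C * (1 / 2) ^ k)" .
  qed
  also have "\<dots> = ennreal (2 * C)"
    using sums_mult[OF geometric_sums[of "1 / 2 :: real"], of C] \<open>C \<ge> 0\<close>
    by (subst suminf_ennreal2) (auto simp: sums_iff)
  finally have S: "(\<integral>\<^sup>+\<omega>. (\<Sum>k. ennreal (d k \<omega>)) \<partial>M) \<le> ennreal (2 * C)" .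
  then have "(\<integral>\<^sup>+\<omega>. (\<Sum>k. ennreal (d k \<omega>)) \<partial>M) \<noteq> \<infinity>"
    by (auto simp: top_unique)
  then have fin: "AE \<omega> in M. (\<Sum>k. ennreal (d k \<omega>)) \<noteq> \<infinity>"
    by (intro nn_integral_PInf_AE) auto
  fix n
  have "(\<integral>\<^sup>+\<omega>. ennreal ((norm (X n \<omega> - Y \<omega>))\<^sup>2) \<partial>M) \<le>
      (\<integral>\<^sup>+\<omega>. ennreal (2 / 2 ^ n) * (\<Sum>k. ennreal (d k \<omega>)) \<partial>M)"
  proof (intro nn_integral_mono_AE, use fin in eventually_elim)
    fix \<omega> assume "(\<Sum>k. ennreal (d k \<omega>)) \<noteq> \<infinity>"
    then have summable: "summable (\<lambda>k. d k \<omega>)"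
      by (intro summable_suminf_not_top) (auto simp: d_def)
    have "(norm (X n \<omega> - Y \<omega>))\<^sup>2 \<le> 2 / 2 ^ n * (\<Sum>k. d k \<omega>)"
      using summable_sq_increments_imp_limit[of "\<lambda>n. X n \<omega>" n] summable unfolding d_def Y_def by simp
    then have "ennreal ((norm (X n \<omega> - Y \<omega>))\<^sup>2) \<le> ennreal (2 / 2 ^ n * (\<Sum>k. d k \<omega>))"
      by (rule ennreal_leI)
    also have "\<dots> = ennreal (2 / 2 ^ n) * (\<Sum>k. ennreal (d k \<omega>))"
      using summable by (subst suminf_ennreal2) (auto simp: d_def ennreal_mult[symmetric] suminf_nonneg)
    finally show "ennreal ((norm (X n \<omega> - Y \<omega>))\<^sup>2) \<le> ennreal (2 / 2 ^ n) * (\<Sum>k. ennreal (d k \<omega>))" .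
  qed
  also have "\<dots> = ennreal (2 / 2 ^ n) * (\<integral>\<^sup>+\<omega>. (\<Sum>k. ennreal (d k \<omega>)) \<partial>M)"
    by (rule nn_integral_cmult) measurable
  also have "\<dots> \<le> ennreal (2 / 2 ^ n) * ennreal (2 * C)"
    by (intro mult_left_mono S) simp
  also have "\<dots> = ennreal (4 * C / 2 ^ n)"
    using \<open>C \<ge> 0\<close> by (simp add: ennreal_mult[symmetric])
  finally show "(\<integral>\<^sup>+\<omega>. ennreal ((norm (X n \<omega> - Y \<omega>))\<^sup>2) \<partial>M) \<le> ennreal (4 * C / 2 ^ n)" .
qed

lemma integrable_norm_sq_add:
  fixes f g :: "'b \<Rightarrow> 'a::euclidean_space"
  assumes [measurable]: "f \<in> borel_measurable M" "g \<in> borel_measurable M"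
    and "integrable M (\<lambda>\<omega>. (norm (f \<omega>))\<^sup>2)" "integrable M (\<lambda>\<omega>. (norm (g \<omega>))\<^sup>2)"
  shows "integrable M (\<lambda>\<omega>. (norm (f \<omega> + g \<omega>))\<^sup>2)"
proof (rule Bochner_Integration.integrable_bound)
  show "integrable M (\<lambda>\<omega>. 2 * (norm (f \<omega>))\<^sup>2 + 2 * (norm (g \<omega>))\<^sup>2)"
    using assms by simp
qed (auto simp: norm_add_sq_le)

lemma integrable_norm_sq_diff:
  fixes f g :: "'b \<Rightarrow> 'a::euclidean_space"
  assumes "f \<in> borel_measurable M" "g \<in> borel_measurable M"
    and "integrable M (\<lambda>\<omega>. (norm (f \<omega>))\<^sup>2)" "integrable M (\<lambda>\<omega>. (norm (g \<omega>))\<^sup>2)"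
  shows "integrable M (\<lambda>\<omega>. (norm (f \<omega> - g \<omega>))\<^sup>2)"
  using integrable_norm_sq_add[of f M "\<lambda>\<omega>. - g \<omega>"] assms by simp

lemma integrable_norm_sq_scaleR:
  fixes f :: "'b \<Rightarrow> 'a::euclidean_space"
  assumes "integrable M (\<lambda>\<omega>. (norm (f \<omega>))\<^sup>2)"
  shows "integrable M (\<lambda>\<omega>. (norm (c *\<^sub>R f \<omega>))\<^sup>2)"
  using assms by (simp add: power_mult_distrib)

lemma Minkowski_L2_diff:
  fixes f g :: "'b \<Rightarrow> 'a::euclidean_space"
  assumes "f \<in> borel_measurable M" "g \<in> borel_measurable M"
    and f: "integrable M (\<lambda>\<omega>. (norm (f \<omega>))\<^sup>2)" and g: "integrable M (\<lambda>\<omega>. (norm (g \<omega>))\<^sup>2)"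
  shows "sqrt (\<integral>\<omega>. (norm (f \<omega> - g \<omega>))\<^sup>2 \<partial>M) \<le>
    sqrt (\<integral>\<omega>. (norm (f \<omega>))\<^sup>2 \<partial>M) + sqrt (\<integral>\<omega>. (norm (g \<omega>))\<^sup>2 \<partial>M)"
proof (rule field_le_epsilon)
  define A where "A = (\<integral>\<omega>. (norm (f \<omega>))\<^sup>2 \<partial>M)"
  define B where "B = (\<integral>\<omega>. (norm (g \<omega>))\<^sup>2 \<partial>M)"
  have nonneg: "0 \<le> A" "0 \<le> B"
    by (auto simp: A_def B_def)
  fix e :: real assume "0 < e"
  define a where "a = sqrt A + e / 2"
  define b where "b = sqrt B + e / 2"
  have pos: "0 < a" "0 < b"
    using \<open>0 < e\<close> nonneg by (auto simp: a_def b_def add_nonneg_pos)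
  have "sqrt A \<le> a" "sqrt B \<le> b"
    using \<open>0 < e\<close> by (auto simp: a_def b_def)
  then have le: "A \<le> a\<^sup>2" "B \<le> b\<^sup>2"
    using sqrt_le_D by blast+
  \<comment> \<open>Young's inequality with weight \<open>b / a\<close>; the \<open>e / 2\<close> keeps \<open>a\<close> and \<open>b\<close> away from \<open>0\<close>.\<close>
  have young: "(norm (f \<omega> - g \<omega>))\<^sup>2 \<le> (1 + b / a) * (norm (f \<omega>))\<^sup>2 + (1 + a / b) * (norm (g \<omega>))\<^sup>2" for \<omega>
  proof -
    have "0 \<le> (norm (b *\<^sub>R f \<omega> + a *\<^sub>R g \<omega>))\<^sup>2 / (a * b)"
      using pos by simp
    also have "\<dots> = b / a * (f \<omega> \<bullet> f \<omega>) + a / b * (g \<omega> \<bullet> g \<omega>) + 2 * (f \<omega> \<bullet> g \<omega>)"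
      using pos by (simp add: power2_norm_eq_inner inner_simps inner_commute field_simps)
    finally show ?thesis
      by (simp add: power2_norm_eq_inner inner_simps inner_commute algebra_simps)
  qed
  have "(\<integral>\<omega>. (norm (f \<omega> - g \<omega>))\<^sup>2 \<partial>M) \<le> (\<integral>\<omega>. (1 + b / a) * (norm (f \<omega>))\<^sup>2 + (1 + a / b) * (norm (g \<omega>))\<^sup>2 \<partial>M)"
    by (intro integral_mono integrable_norm_sq_diff assms young) (use f g in simp)
  also have "\<dots> = (1 + b / a) * A + (1 + a / b) * B"
    using f g by (simp add: A_def B_def)
  also have "\<dots> \<le> (1 + b / a) * a\<^sup>2 + (1 + a / b) * b\<^sup>2"
    using le pos by (intro add_mono mult_left_mono) auto
  also have "\<dots> = (a + b)\<^sup>2"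
    using pos by (simp add: field_simps power2_eq_square)
  finally have "sqrt (\<integral>\<omega>. (norm (f \<omega> - g \<omega>))\<^sup>2 \<partial>M) \<le> a + b"
    using pos by (intro real_le_lsqrt) auto
  then show "sqrt (\<integral>\<omega>. (norm (f \<omega> - g \<omega>))\<^sup>2 \<partial>M) \<le> sqrt A + sqrt B + e"
    by (simp add: a_def b_def)
qed

section \<open>The Wasserstein distance\<close>

lemma P2_prob_space: "\<mu> \<in> P2 \<Longrightarrow> prob_space \<mu>"
  and P2_sets: "\<mu> \<in> P2 \<Longrightarrow> sets \<mu> = sets borel"
  and P2_integrable: "\<mu> \<in> P2 \<Longrightarrow> integrable \<mu> (\<lambda>x. (norm x)\<^sup>2)"
  by (auto simp: P2_def)

lemma distr_in_P2_iff:
  assumes "prob_space M" and [measurable]: "f \<in> borel_measurable M"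
  shows "distr M borel f \<in> P2 \<longleftrightarrow> integrable M (\<lambda>\<omega>. (norm (f \<omega>))\<^sup>2)"
  using assms by (simp add: P2_def prob_space.prob_space_distr integrable_distr_eq)

lemma W2_nonneg: "0 \<le> W2 \<mu> \<nu>"
  by (simp add: W2_def)

lemma W2_sq: "(W2 \<mu> \<nu>)\<^sup>2 = enn2real (INF \<gamma>\<in>couplings \<mu> \<nu>. transport_cost \<gamma>)"
  by (simp add: W2_def)

lemma borel_measurable_fst [measurable]:
    "fst \<in> borel_measurable (borel :: ('a::topological_space \<times> 'b::topological_space) measure)"
  and borel_measurable_snd [measurable]:
    "snd \<in> borel_measurable (borel :: ('a::topological_space \<times> 'b::topological_space) measure)"
  by (auto intro!: borel_measurable_continuous_onI continuous_intros)

lemma transport_cost_distr: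
  fixes X Y :: "'b \<Rightarrow> 'a::euclidean_space"
  assumes [measurable]: "X \<in> borel_measurable M" "Y \<in> borel_measurable M"
  shows "transport_cost (distr M borel (\<lambda>\<omega>. (X \<omega>, Y \<omega>))) = (\<integral>\<^sup>+\<omega>. ennreal ((norm (X \<omega> - Y \<omega>))\<^sup>2) \<partial>M)"
  unfolding transport_cost_def by (subst nn_integral_distr) simp_all

text \<open>The joint law of \<open>X\<close> and \<open>Y\<close> is one admissible coupling. Upper
  bounds on \<open>W2\<close> thus reduce to choosing two random variables on a common
  space.\<close>

lemma W2_sq_le:
  fixes X Y :: "'b \<Rightarrow> 'a::euclidean_space"
  assumes "prob_space M" and [measurable]: "X \<in> borel_measurable M" "Y \<in> borel_measurable M"
    and int: "integrable M (\<lambda>\<omega>. (norm (X \<omega> - Y \<omega>))\<^sup>2)"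
  shows "(W2 (distr M borel X) (distr M borel Y))\<^sup>2 \<le> (\<integral>\<omega>. (norm (X \<omega> - Y \<omega>))\<^sup>2 \<partial>M)"
proof -
  let ?\<gamma> = "distr M borel (\<lambda>\<omega>. (X \<omega>, Y \<omega>))"
  have "?\<gamma> \<in> couplings (distr M borel X) (distr M borel Y)"
    using assms(1) unfolding couplings_def
    by (auto intro!: prob_space.prob_space_distr simp: distr_distr comp_def)
  then have "(INF \<gamma>\<in>couplings (distr M borel X) (distr M borel Y). transport_cost \<gamma>) \<le> transport_cost ?\<gamma>"
    by (rule INF_lower)
  also have "\<dots> = ennreal (\<integral>\<omega>. (norm (X \<omega> - Y \<omega>))\<^sup>2 \<partial>M)"
    using int by (simp add: transport_cost_distr nn_integral_eq_integral)
  finally show ?thesis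
    unfolding W2_sq by (intro enn2real_leI) simp_all
qed

text \<open>For an infinite cost both the Bochner integral and \<open>enn2real\<close> give 0, so
  the identity covers that case as well.\<close>

lemma W2_sq_optimal:
  fixes X Y :: "'b \<Rightarrow> 'a::euclidean_space"
  assumes [measurable]: "X \<in> borel_measurable M" "Y \<in> borel_measurable M"
    and "distr M borel (\<lambda>\<omega>. (X \<omega>, Y \<omega>)) \<in> opt_couplings \<mu> \<nu>"
  shows "(W2 \<mu> \<nu>)\<^sup>2 = (\<integral>\<omega>. (norm (X \<omega> - Y \<omega>))\<^sup>2 \<partial>M)"
  using assms unfolding W2_sq opt_couplings_def
  by (simp add: integral_eq_nn_integral transport_cost_distr[symmetric])

lemma W2_self: "\<mu> \<in> P2 \<Longrightarrow> W2 \<mu> \<mu> = 0"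
  using W2_sq_le[of \<mu> "\<lambda>x. x" "\<lambda>x. x"] P2_prob_space[of \<mu>] P2_sets[of \<mu>]
  by (simp add: distr_id2 measurable_ident_sets)

section \<open>Discretization of measures\<close>

lemma pmf_of_countable_prob_space:
  fixes M :: "'a::countable measure"
  assumes "prob_space M" "sets M = UNIV"
  shows "\<exists>p. measure_pmf p = M"
proof -
  interpret prob_space M by fact
  have "AE x in M. measure M {x} \<noteq> 0"
    using assms(2) by (subst AE_support_countable) (auto intro: exI[of _ UNIV])
  then show ?thesis
    using assms by (intro exI[of _ "Abs_pmf M"]) (simp add: Abs_pmf_inverse)
qed

text \<open>\<open>g\<close> enumerates a countable dense set and \<open>R x\<close> is the first
  index whose point is close to \<open>x\<close>; choosing the least index makes \<open>R\<close>
  measurable.\<close>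

lemma quantization:
  assumes "0 < \<epsilon>"
  shows "\<exists>(g :: nat \<Rightarrow> 'a::euclidean_space) R. R \<in> measurable borel (count_space UNIV) \<and> (\<forall>x. norm (x - g (R x)) < \<epsilon>)"
proof -
  obtain D :: "'a set" where D: "countable D" "\<And>X. open X \<Longrightarrow> X \<noteq> {} \<Longrightarrow> \<exists>d\<in>D. d \<in> X"
    using countable_dense_setE by blast
  have "D \<noteq> {}"
    using D(2)[of UNIV] by auto
  define g where "g = from_nat_into D"
  have g: "\<exists>n. norm (x - g n) < \<epsilon>" for x
  proof -
    obtain d where "d \<in> D" "d \<in> ball x \<epsilon>"
      using D(2)[of "ball x \<epsilon>"] assms by auto
    then show ?thesis
      using from_nat_into_surj[OF D(1)] by (auto simp: g_def dist_norm)
  qed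
  define R where "R x = (LEAST n. norm (x - g n) < \<epsilon>)" for x
  have "R \<in> measurable borel (count_space UNIV)"
    unfolding R_def by measurable
  moreover have "norm (x - g (R x)) < \<epsilon>" for x
    unfolding R_def using g by (rule LeastI_ex)
  ultimately show ?thesis
    by blast
qed

text \<open>The right side minus the left side is the sum of the three squared pairwise
  distances.\<close>

lemma norm_add3_sq_le: "(norm (x + y + z))\<^sup>2 \<le> 3 * (norm x)\<^sup>2 + 3 * (norm y)\<^sup>2 + 3 * (norm z)\<^sup>2"
  for x y z :: "'a::real_inner"
proof -
  have "0 \<le> (norm (x - y))\<^sup>2 + (norm (y - z))\<^sup>2 + (norm (x - z))\<^sup>2"
    by simp
  then show ?thesis
    by (simp add: power2_norm_eq_inner inner_simps inner_commute)
qed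

text \<open>Points move by at most \<open>\<epsilon>\<close>, so the displacement is bounded and
  hence square integrable, and moving each \<open>x\<close> to \<open>f x\<close> is a coupling of
  cost at most \<open>\<epsilon>\<^sup>2\<close>.\<close>

lemma distr_quantized_in_P2:
  fixes f :: "'a::euclidean_space \<Rightarrow> 'a"
  assumes "\<mu> \<in> P2" and [measurable]: "f \<in> borel_measurable borel"
    and near: "\<And>x. norm (x - f x) \<le> \<epsilon>"
  shows "distr \<mu> borel f \<in> P2" and "(W2 (distr \<mu> borel f) \<mu>)\<^sup>2 \<le> \<epsilon>\<^sup>2"
proof -
  interpret prob_space \<mu>
    using assms(1) by (rule P2_prob_space)
  note sets_cong = measurable_cong_sets[OF P2_sets[OF assms(1)] refl]
  have f [measurable]: "f \<in> borel_measurable \<mu>" and id [measurable]: "(\<lambda>x. x) \<in> borel_measurable \<mu>"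
    by (simp_all add: sets_cong assms(2))
  have sq: "(norm (f x - x))\<^sup>2 \<le> \<epsilon>\<^sup>2" for x
    using near[of x] by (simp add: norm_minus_commute power_mono)
  have int: "integrable \<mu> (\<lambda>x. (norm (f x - x))\<^sup>2)"
    by (rule integrable_const_bound[of _ "\<epsilon>\<^sup>2"]) (auto simp: sq)
  have "integrable \<mu> (\<lambda>x. (norm (f x - x + x))\<^sup>2)"
    by (intro integrable_norm_sq_add int P2_integrable[OF assms(1)] borel_measurable_diff f id)
  then show "distr \<mu> borel f \<in> P2"
    using prob_space_axioms by (simp add: distr_in_P2_iff)
  have "(W2 (distr \<mu> borel f) \<mu>)\<^sup>2 = (W2 (distr \<mu> borel f) (distr \<mu> borel (\<lambda>x. x)))\<^sup>2"
    using P2_sets[OF assms(1)] by (simp add: distr_id2)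
  also have "\<dots> \<le> (\<integral>x. (norm (f x - x))\<^sup>2 \<partial>\<mu>)"
    by (rule W2_sq_le) (use int prob_space_axioms in auto)
  also have "\<dots> \<le> (\<integral>x. \<epsilon>\<^sup>2 \<partial>\<mu>)"
    by (intro integral_mono int sq) simp
  finally show "(W2 (distr \<mu> borel f) \<mu>)\<^sup>2 \<le> \<epsilon>\<^sup>2"
    by (simp add: prob_space)
qed

section \<open>Optimal couplings, metric properties and completeness of the Wasserstein
  distance\<close>

locale gen_geodesically_convex =
  fixes H :: "'a::euclidean_space measure \<Rightarrow> ereal"
  assumes convex: "convex_along_gen_geodesics H"
begin

text \<open>The three-plan is repackaged as three random variables on one space, with optimality of
  the two pairs containing the base \<open>X\<close> expressed as formulas for \<open>W2\<close>.
  This is the only form in which convexity of \<open>H\<close> is used later.\<close>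

lemma convex_three_plan:
  fixes \<nu> \<mu>0 \<mu>1 :: "'a measure"
  assumes "\<nu> \<in> P2" "\<mu>0 \<in> P2" "\<mu>1 \<in> P2"
  obtains M :: "('a \<times> 'a \<times> 'a) measure" and X Y Z
  where "prob_space M" "X \<in> borel_measurable M" "Y \<in> borel_measurable M" "Z \<in> borel_measurable M"
    "distr M borel X = \<nu>" "distr M borel Y = \<mu>0" "distr M borel Z = \<mu>1"
    "(W2 \<nu> \<mu>0)\<^sup>2 = (\<integral>\<omega>. (norm (X \<omega> - Y \<omega>))\<^sup>2 \<partial>M)"
    "(W2 \<nu> \<mu>1)\<^sup>2 = (\<integral>\<omega>. (norm (X \<omega> - Z \<omega>))\<^sup>2 \<partial>M)"
    "\<And>s. s \<in> {0..1} \<Longrightarrow> H (distr M borel (\<lambda>\<omega>. (1 - s) *\<^sub>R Y \<omega> + s *\<^sub>R Z \<omega>)) \<le>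
      ereal (1 - s) * H \<mu>0 + ereal s * H \<mu>1"
proof -
  obtain m where m: "generalized_geodesic \<nu> \<mu>0 \<mu>1 m"
    and Hm: "\<And>s. s \<in> {0..1} \<Longrightarrow> H (m s) \<le> ereal (1 - s) * H \<mu>0 + ereal s * H \<mu>1"
    using convex assms unfolding convex_along_gen_geodesics_def by blast
  obtain M :: "('a \<times> 'a \<times> 'a) measure" where M: "prob_space M" "sets M = sets borel"
    "distr M borel (\<lambda>(x, y, z). x) = \<nu>" "distr M borel (\<lambda>(x, y, z). y) = \<mu>0"
    "distr M borel (\<lambda>(x, y, z). z) = \<mu>1"
    "distr M borel (\<lambda>(x, y, z). (x, y)) \<in> opt_couplings \<nu> \<mu>0"
    "distr M borel (\<lambda>(x, y, z). (x, z)) \<in> opt_couplings \<nu> \<mu>1"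
    "\<And>t. t \<in> {0..1} \<Longrightarrow> m t = distr M borel (\<lambda>(x, y, z). (1 - t) *\<^sub>R y + t *\<^sub>R z)"
    using m unfolding generalized_geodesic_def by blast
  define X :: "'a \<times> 'a \<times> 'a \<Rightarrow> 'a" where "X = fst"
  define Y :: "'a \<times> 'a \<times> 'a \<Rightarrow> 'a" where "Y \<omega> = fst (snd \<omega>)" for \<omega>
  define Z :: "'a \<times> 'a \<times> 'a \<Rightarrow> 'a" where "Z \<omega> = snd (snd \<omega>)" for \<omega>
  note [measurable_cong] = M(2)
  have meas: "X \<in> borel_measurable M" "Y \<in> borel_measurable M" "Z \<in> borel_measurable M"
    unfolding X_def Y_def Z_def by measurable
  show thesis
  proof
    show "(W2 \<nu> \<mu>0)\<^sup>2 = (\<integral>\<omega>. (norm (X \<omega> - Y \<omega>))\<^sup>2 \<partial>M)"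
      by (rule W2_sq_optimal) (use M(6) meas in \<open>simp_all add: X_def Y_def case_prod_beta'\<close>)
    show "(W2 \<nu> \<mu>1)\<^sup>2 = (\<integral>\<omega>. (norm (X \<omega> - Z \<omega>))\<^sup>2 \<partial>M)"
      by (rule W2_sq_optimal) (use M(7) meas in \<open>simp_all add: X_def Z_def case_prod_beta'\<close>)
    show "H (distr M borel (\<lambda>\<omega>. (1 - s) *\<^sub>R Y \<omega> + s *\<^sub>R Z \<omega>)) \<le> ereal (1 - s) * H \<mu>0 + ereal s * H \<mu>1"
      if "s \<in> {0..1}" for s
      using Hm[OF that] M(8)[OF that] by (simp add: Y_def Z_def case_prod_beta')
  qed (use M meas in \<open>simp_all add: X_def Y_def Z_def case_prod_beta'\<close>)
qed

text \<open>A three-plan with base \<open>\<mu>\<close> and both end points equal to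
  \<open>\<nu>\<close> contains an optimal plan; its third variable is discarded.\<close>

lemma optimal_coupling:
  fixes \<mu> \<nu> :: "'a measure"
  assumes "\<mu> \<in> P2" "\<nu> \<in> P2"
  obtains M :: "('a \<times> 'a \<times> 'a) measure" and X Y
  where "prob_space M" "X \<in> borel_measurable M" "Y \<in> borel_measurable M"
    "distr M borel X = \<mu>" "distr M borel Y = \<nu>"
    "integrable M (\<lambda>\<omega>. (norm (X \<omega>))\<^sup>2)" "integrable M (\<lambda>\<omega>. (norm (Y \<omega>))\<^sup>2)"
    "(W2 \<mu> \<nu>)\<^sup>2 = (\<integral>\<omega>. (norm (X \<omega> - Y \<omega>))\<^sup>2 \<partial>M)"
proof (rule convex_three_plan[OF assms(1,2,2)])
  fix M :: "('a \<times> 'a \<times> 'a) measure" and X Y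
  assume "prob_space M" "X \<in> borel_measurable M" "Y \<in> borel_measurable M"
    "distr M borel X = \<mu>" "distr M borel Y = \<nu>"
    "(W2 \<mu> \<nu>)\<^sup>2 = (\<integral>\<omega>. (norm (X \<omega> - Y \<omega>))\<^sup>2 \<partial>M)"
  then show thesis
    using that[of M X Y] assms by (auto simp: distr_in_P2_iff[symmetric])
qed

text \<open>The three-plan with base \<open>\<nu>\<close> is already a gluing of two optimal plans
  along \<open>\<nu>\<close>. Its pair \<open>Y\<close>, \<open>Z\<close> couples the end points,
  and Minkowski's inequality bounds the cost.\<close>

lemma W2_triangle_base:
  fixes \<nu> \<mu>0 \<mu>1 :: "'a measure"
  assumes "\<nu> \<in> P2" "\<mu>0 \<in> P2" "\<mu>1 \<in> P2"
  shows "W2 \<mu>0 \<mu>1 \<le> W2 \<nu> \<mu>0 + W2 \<nu> \<mu>1"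
proof (rule convex_three_plan[OF assms])
  fix M :: "('a \<times> 'a \<times> 'a) measure" and X Y Z
  assume M: "prob_space M"
    and [measurable]: "X \<in> borel_measurable M" "Y \<in> borel_measurable M" "Z \<in> borel_measurable M"
    and distr: "distr M borel X = \<nu>" "distr M borel Y = \<mu>0" "distr M borel Z = \<mu>1"
    and W: "(W2 \<nu> \<mu>0)\<^sup>2 = (\<integral>\<omega>. (norm (X \<omega> - Y \<omega>))\<^sup>2 \<partial>M)"
      "(W2 \<nu> \<mu>1)\<^sup>2 = (\<integral>\<omega>. (norm (X \<omega> - Z \<omega>))\<^sup>2 \<partial>M)"
  have int: "integrable M (\<lambda>\<omega>. (norm (X \<omega>))\<^sup>2)" "integrable M (\<lambda>\<omega>. (norm (Y \<omega>))\<^sup>2)"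
    "integrable M (\<lambda>\<omega>. (norm (Z \<omega>))\<^sup>2)"
    using assms M by (simp_all add: distr_in_P2_iff[symmetric] distr)
  have "(W2 \<mu>0 \<mu>1)\<^sup>2 \<le> (\<integral>\<omega>. (norm (Y \<omega> - Z \<omega>))\<^sup>2 \<partial>M)"
    unfolding distr[symmetric] by (intro W2_sq_le M integrable_norm_sq_diff int) simp_all
  then have "W2 \<mu>0 \<mu>1 \<le> sqrt (\<integral>\<omega>. (norm ((X \<omega> - Z \<omega>) - (X \<omega> - Y \<omega>)))\<^sup>2 \<partial>M)"
    by (simp add: real_le_rsqrt)
  also have "\<dots> \<le> sqrt (\<integral>\<omega>. (norm (X \<omega> - Z \<omega>))\<^sup>2 \<partial>M) + sqrt (\<integral>\<omega>. (norm (X \<omega> - Y \<omega>))\<^sup>2 \<partial>M)"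
    by (intro Minkowski_L2_diff integrable_norm_sq_diff int) simp_all
  also have "\<dots> = W2 \<nu> \<mu>0 + W2 \<nu> \<mu>1"
    by (simp add: W2_nonneg flip: W)
  finally show ?thesis .
qed

text \<open>Taking one end point equal to the base in \<open>W2_triangle_base\<close> gives an
  inequality in each direction, since the distance from a measure to itself vanishes.\<close>

lemma W2_commute:
  fixes \<mu> \<nu> :: "'a measure"
  assumes "\<mu> \<in> P2" "\<nu> \<in> P2"
  shows "W2 \<mu> \<nu> = W2 \<nu> \<mu>"
  using W2_triangle_base[of \<nu> \<mu> \<nu>] W2_triangle_base[of \<mu> \<nu> \<mu>] W2_self[of \<mu>] W2_self[of \<nu>] assms by simp

lemma W2_triangle:
  fixes \<mu> \<nu> \<rho> :: "'a measure"
  assumes "\<mu> \<in> P2" "\<nu> \<in> P2" "\<rho> \<in> P2"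
  shows "W2 \<mu> \<rho> \<le> W2 \<mu> \<nu> + W2 \<nu> \<rho>"
  using W2_triangle_base[of \<nu> \<mu> \<rho>] W2_commute[of \<mu> \<nu>] assms by simp

text \<open>
  Gluing optimal plans along a sequence would need disintegration. It is elementary for countably
  supported measures, so each measure is first quantized at scale \<open>2\<^sup>-\<^sup>n\<close>.
\<close>

lemma W2_fast_Cauchy_convergent:
  fixes u :: "nat \<Rightarrow> 'a measure"
  assumes u: "\<And>n. u n \<in> P2" and "C \<ge> 0" and fast: "\<And>n. (W2 (u n) (u (Suc n)))\<^sup>2 \<le> C / 4 ^ n"
  obtains \<mu> where "\<mu> \<in> P2" "(\<lambda>n. W2 (u n) \<mu>) \<longlonglongrightarrow> 0"
proof -
  have "\<exists>(g :: nat \<Rightarrow> 'a) R. R \<in> measurable borel (count_space UNIV) \<and> (\<forall>x. norm (x - g (R x)) < (1 / 2) ^ n)" for n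
    by (rule quantization) simp
  then obtain g :: "nat \<Rightarrow> nat \<Rightarrow> 'a" and R :: "nat \<Rightarrow> 'a \<Rightarrow> nat"
    where [measurable]: "\<And>n. R n \<in> measurable borel (count_space UNIV)"
      and near: "\<And>n x. norm (x - g n (R n x)) < (1 / 2) ^ n"
    by metis
  have near_sq: "(norm (x - g n (R n x)))\<^sup>2 \<le> 1 / 4 ^ n" for n x
  proof -
    have "(norm (x - g n (R n x)))\<^sup>2 \<le> ((1 / 2) ^ n)\<^sup>2"
      using near[of x n] by (intro power_mono) auto
    also have "\<dots> = 1 / 4 ^ n"
      by (simp add: power_mult[symmetric] mult.commute[of n] power_mult power_one_over)
    finally show ?thesis .
  qed
  \<comment> \<open>\<open>norm_add3_sq_le\<close> puts a factor 3 on the transport cost and on the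
    two quantization errors, each at most \<open>1 / 4 ^ n\<close>.\<close>
  define C' where "C' = 3 * C + 6"
  have "C' \<ge> 0"
    using \<open>C \<ge> 0\<close> by (simp add: C'_def)
  have R_u [measurable]: "R n \<in> measurable (u n) (count_space UNIV)" for n
    by (simp add: measurable_cong_sets[OF P2_sets[OF u] refl])
  have "\<exists>q. measure_pmf q = distr (u n) (count_space UNIV) (R n)" for n
    using prob_space.prob_space_distr[OF P2_prob_space[OF u] R_u] by (intro pmf_of_countable_prob_space) simp_all
  then obtain q where q: "\<And>n. measure_pmf (q n) = distr (u n) (count_space UNIV) (R n)"
    by metis
  \<comment> \<open>\<open>p\<close> couples natural-number labels, while the cost is measured after
    decoding them by \<open>g\<close>. Such a \<open>p\<close> arises by quantizing both variables
    of an optimal pair.\<close>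
  define coupled where "coupled n p \<longleftrightarrow> map_pmf fst p = q n \<and> map_pmf snd p = q (Suc n) \<and>
      (\<integral>\<^sup>+z. ennreal ((norm (g n (fst z) - g (Suc n) (snd z)))\<^sup>2) \<partial>measure_pmf p) \<le> ennreal (C' / 4 ^ n)" for n p
  have "\<exists>p. coupled n p" for n
  proof (rule optimal_coupling[OF u[of n] u[of "Suc n"]])
    fix M :: "('a \<times> 'a \<times> 'a) measure" and X Y
    assume "prob_space M"
      and [measurable]: "X \<in> borel_measurable M" "Y \<in> borel_measurable M"
      and distr: "distr M borel X = u n" "distr M borel Y = u (Suc n)"
      and sq_int: "integrable M (\<lambda>\<omega>. (norm (X \<omega>))\<^sup>2)" "integrable M (\<lambda>\<omega>. (norm (Y \<omega>))\<^sup>2)"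
      and W: "(W2 (u n) (u (Suc n)))\<^sup>2 = (\<integral>\<omega>. (norm (X \<omega> - Y \<omega>))\<^sup>2 \<partial>M)"
    interpret prob_space M by fact
    define P where "P \<omega> = (R n (X \<omega>), R (Suc n) (Y \<omega>))" for \<omega>
    have P [measurable]: "P \<in> measurable M (count_space UNIV)"
      using measurable_Pair[of "\<lambda>\<omega>. R n (X \<omega>)" M "count_space UNIV" "\<lambda>\<omega>. R (Suc n) (Y \<omega>)" "count_space UNIV"]
      by (simp add: pair_measure_countable P_def[abs_def])
    obtain p where p: "measure_pmf p = distr M (count_space UNIV) P"
      using pmf_of_countable_prob_space[OF prob_space_distr[OF P]] by auto
    have "map_pmf fst p = q n" "map_pmf snd p = q (Suc n)"
      unfolding measure_pmf_inject[symmetric] map_pmf_rep_eq p q distr[symmetric]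
      by (simp_all add: distr_distr comp_def P_def)
    moreover have "(\<integral>\<^sup>+z. ennreal ((norm (g n (fst z) - g (Suc n) (snd z)))\<^sup>2) \<partial>measure_pmf p) \<le> ennreal (C' / 4 ^ n)"
    proof -
      have int: "integrable M (\<lambda>\<omega>. (norm (X \<omega> - Y \<omega>))\<^sup>2)"
        by (intro integrable_norm_sq_diff sq_int) simp_all
      have bound: "(norm (g n (R n (X \<omega>)) - g (Suc n) (R (Suc n) (Y \<omega>))))\<^sup>2 \<le>
          3 * (norm (X \<omega> - Y \<omega>))\<^sup>2 + 6 / 4 ^ n" for \<omega>
      proof -
        have "(norm (g n (R n (X \<omega>)) - g (Suc n) (R (Suc n) (Y \<omega>))))\<^sup>2 \<le>
            3 * (norm (g n (R n (X \<omega>)) - X \<omega>))\<^sup>2 + 3 * (norm (X \<omega> - Y \<omega>))\<^sup>2 +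
            3 * (norm (Y \<omega> - g (Suc n) (R (Suc n) (Y \<omega>))))\<^sup>2"
          using norm_add3_sq_le[of "g n (R n (X \<omega>)) - X \<omega>" "X \<omega> - Y \<omega>" "Y \<omega> - g (Suc n) (R (Suc n) (Y \<omega>))"]
          by simp
        moreover have "(norm (g n (R n (X \<omega>)) - X \<omega>))\<^sup>2 \<le> 1 / 4 ^ n"
          using near_sq[of "X \<omega>" n] by (simp add: norm_minus_commute)
        moreover have "(norm (Y \<omega> - g (Suc n) (R (Suc n) (Y \<omega>))))\<^sup>2 \<le> 1 / 4 ^ n"
          using near_sq[of "Y \<omega>" "Suc n"] by (rule order_trans) (simp add: field_simps)
        ultimately show ?thesis
          by simp
      qed
      have "(\<integral>\<^sup>+z. ennreal ((norm (g n (fst z) - g (Suc n) (snd z)))\<^sup>2) \<partial>measure_pmf p) =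
          (\<integral>\<^sup>+\<omega>. ennreal ((norm (g n (R n (X \<omega>)) - g (Suc n) (R (Suc n) (Y \<omega>))))\<^sup>2) \<partial>M)"
        unfolding p by (subst nn_integral_distr) (simp_all add: P_def)
      also have "\<dots> \<le> (\<integral>\<^sup>+\<omega>. ennreal (3 * (norm (X \<omega> - Y \<omega>))\<^sup>2 + 6 / 4 ^ n) \<partial>M)"
        by (intro nn_integral_mono ennreal_leI bound)
      also have "\<dots> = ennreal (\<integral>\<omega>. 3 * (norm (X \<omega> - Y \<omega>))\<^sup>2 + 6 / 4 ^ n \<partial>M)"
        by (intro nn_integral_eq_integral) (use int in auto)
      also have "(\<integral>\<omega>. 3 * (norm (X \<omega> - Y \<omega>))\<^sup>2 + 6 / 4 ^ n \<partial>M) = 3 * (W2 (u n) (u (Suc n)))\<^sup>2 + 6 / 4 ^ n"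
        using int by (simp add: W prob_space)
      also have "ennreal \<dots> \<le> ennreal (C' / 4 ^ n)"
        using fast[of n] by (intro ennreal_leI) (simp add: C'_def add_divide_distrib)
      finally show ?thesis .
    qed
    ultimately show ?thesis
      unfolding coupled_def by blast
  qed
  then obtain p where "\<And>n. coupled n (p n)"
    by metis
  then have p: "\<And>n. map_pmf fst (p n) = q n" "\<And>n. map_pmf snd (p n) = q (Suc n)"
    and close: "\<And>n. (\<integral>\<^sup>+z. ennreal ((norm (g n (fst z) - g (Suc n) (snd z)))\<^sup>2) \<partial>measure_pmf (p n)) \<le> ennreal (C' / 4 ^ n)"
    unfolding coupled_def by blast+
  obtain M :: "(nat \<Rightarrow> nat) measure" where "prob_space M"
    and sets_M: "sets M = sets (PiM UNIV (\<lambda>_. count_space UNIV))"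
    and chain: "\<And>n f. (\<integral>\<^sup>+\<omega>. f (\<omega> n, \<omega> (Suc n)) \<partial>M) = (\<integral>\<^sup>+z. f z \<partial>measure_pmf (p n))"
    by (rule markov_sequence[of p]) (auto simp: p)
  interpret prob_space M by fact
  \<comment> \<open>All quantized measures now live on one probability space: decoding coordinate
    \<open>n\<close> of the chain gives a variable whose law is the quantization of
    \<open>u n\<close>.\<close>
  define Z where "Z n \<omega> = g n (\<omega> n)" for n and \<omega> :: "nat \<Rightarrow> nat"
  have coord [measurable]: "(\<lambda>\<omega>. \<omega> n) \<in> measurable M (count_space UNIV)" for n
    unfolding measurable_cong_sets[OF sets_M refl] by (rule measurable_component_singleton) simp
  have Z [measurable]: "Z n \<in> borel_measurable M" for n
    unfolding Z_def by (rule measurable_compose[OF coord]) simp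
  have coord_law: "distr M (count_space UNIV) (\<lambda>\<omega>. \<omega> n) = measure_pmf (q n)" for n
  proof (rule measure_eqI)
    fix A assume "A \<in> sets (distr M (count_space UNIV) (\<lambda>\<omega>. \<omega> n))"
    have "emeasure (distr M (count_space UNIV) (\<lambda>\<omega>. \<omega> n)) A = (\<integral>\<^sup>+\<omega>. indicator A (\<omega> n) \<partial>M)"
      using nn_integral_distr[OF coord, of "indicator A" n] by simp
    also have "\<dots> = (\<integral>\<^sup>+z. indicator A (fst z) \<partial>measure_pmf (p n))"
      using chain[of "\<lambda>z. indicator A (fst z)" n] by simp
    also have "\<dots> = (\<integral>\<^sup>+z. indicator A z \<partial>map_pmf fst (p n))"
      by (rule nn_integral_map_pmf[symmetric])
    also have "\<dots> = emeasure (measure_pmf (q n)) A"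
      by (simp add: p(1))
    finally show "emeasure (distr M (count_space UNIV) (\<lambda>\<omega>. \<omega> n)) A = emeasure (measure_pmf (q n)) A" .
  qed simp
  have law: "distr M borel (Z n) = distr (u n) borel (\<lambda>x. g n (R n x))" for n
  proof -
    have "distr M borel (Z n) = distr (distr M (count_space UNIV) (\<lambda>\<omega>. \<omega> n)) borel (g n)"
      by (subst distr_distr) (simp_all add: Z_def[abs_def] comp_def)
    also have "\<dots> = distr (distr (u n) (count_space UNIV) (R n)) borel (g n)"
      by (simp add: coord_law q)
    also have "\<dots> = distr (u n) borel (\<lambda>x. g n (R n x))"
      by (subst distr_distr) (simp_all add: comp_def)
    finally show ?thesis .
  qed
  have gR: "(\<lambda>x. g n (R n x)) \<in> borel_measurable borel" for n
    by (rule measurable_compose[of "R n" _ "count_space UNIV"]) simp_all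
  have ZP2: "distr M borel (Z n) \<in> P2" for n
    unfolding law using distr_quantized_in_P2(1)[OF u gR less_imp_le[OF near]] .
  have uZ: "(W2 (distr M borel (Z n)) (u n))\<^sup>2 \<le> ((1 / 2) ^ n)\<^sup>2" for n
    unfolding law using distr_quantized_in_P2(2)[OF u gR less_imp_le[OF near]] .
  have step: "(\<integral>\<^sup>+\<omega>. ennreal ((norm (Z n \<omega> - Z (Suc n) \<omega>))\<^sup>2) \<partial>M) \<le> ennreal (C' / 4 ^ n)" for n
    using close[of n] chain[of "\<lambda>z. ennreal ((norm (g n (fst z) - g (Suc n) (snd z)))\<^sup>2)" n]
    by (simp add: Z_def)
  obtain Y where [measurable]: "Y \<in> borel_measurable M"
    and Y: "\<And>n. (\<integral>\<^sup>+\<omega>. ennreal ((norm (Z n \<omega> - Y \<omega>))\<^sup>2) \<partial>M) \<le> ennreal (4 * C' / 2 ^ n)"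
    by (rule L2_limit_of_fast_Cauchy[of Z M C', OF Z \<open>C' \<ge> 0\<close> step]) blast
  have int: "integrable M (\<lambda>\<omega>. (norm (Z n \<omega> - Y \<omega>))\<^sup>2)" for n
    using Y[of n] by (intro integrableI_bounded) (auto simp: less_top[symmetric] top_unique)
  have Y': "(\<integral>\<omega>. (norm (Z n \<omega> - Y \<omega>))\<^sup>2 \<partial>M) \<le> 4 * C' / 2 ^ n" for n
    using Y[of n] \<open>C' \<ge> 0\<close> by (simp add: nn_integral_eq_integral[OF int])
  \<comment> \<open>Writing \<open>Y\<close> as \<open>Z 0 - (Z 0 - Y)\<close> transfers the finite
    second moment from \<open>Z 0\<close> to the limit.\<close>
  have "integrable M (\<lambda>\<omega>. (norm (Z 0 \<omega> - (Z 0 \<omega> - Y \<omega>)))\<^sup>2)"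
    using ZP2[of 0] prob_space_axioms by (intro integrable_norm_sq_diff int) (simp_all add: distr_in_P2_iff)
  then have YP2: "distr M borel Y \<in> P2"
    using prob_space_axioms by (simp add: distr_in_P2_iff)
  \<comment> \<open>The first term is the quantization error of \<open>u n\<close>, the second the
    \<open>L2\<close> distance from the decoded chain to its limit.\<close>
  have rate: "W2 (u n) (distr M borel Y) \<le> (1 / 2) ^ n + sqrt (4 * C' / 2 ^ n)" for n
  proof -
    have "(W2 (distr M borel (Z n)) (distr M borel Y))\<^sup>2 \<le> 4 * C' / 2 ^ n"
      using W2_sq_le[OF prob_space_axioms, of "Z n" Y] int[of n] Y'[of n] by simp
    then have "W2 (distr M borel (Z n)) (distr M borel Y) \<le> sqrt (4 * C' / 2 ^ n)"
      by (rule real_le_rsqrt)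
    moreover have "W2 (distr M borel (Z n)) (u n) \<le> (1 / 2) ^ n"
      using uZ[of n] by (rule power2_le_imp_le) simp
    ultimately show ?thesis
      using W2_triangle_base[OF ZP2 u YP2, of n n] by linarith
  qed
  have "(\<lambda>n. (1 / 2) ^ n + sqrt (4 * C' / 2 ^ n)) \<longlonglongrightarrow> 0 + sqrt 0"
    by (intro tendsto_intros LIMSEQ_power_zero LIMSEQ_divide_realpow_zero) auto
  then have "(\<lambda>n. (1 / 2) ^ n + sqrt (4 * C' / 2 ^ n)) \<longlonglongrightarrow> 0"
    by simp
  then have "(\<lambda>n. W2 (u n) (distr M borel Y)) \<longlonglongrightarrow> 0"
    by (rule Lim_null_comparison[rotated]) (simp add: W2_nonneg rate)
  with YP2 show thesis
    by (rule that)
qed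

end

section \<open>The proximal step\<close>

text \<open>This is the exact form of the uniform convexity of the squared distance from
  \<open>x\<close>. Integrated over a three-plan with base variable \<open>x\<close>, it becomes
  convexity of the squared distance from the base measure.\<close>

lemma norm_convex_combination_sq:
  fixes x y z :: "'a::real_inner"
  shows "(norm ((1 - s) *\<^sub>R y + s *\<^sub>R z - x))\<^sup>2 =
    (1 - s) * (norm (x - y))\<^sup>2 + s * (norm (x - z))\<^sup>2 - s * (1 - s) * (norm (y - z))\<^sup>2"
  by (simp add: power2_norm_eq_inner inner_simps inner_commute algebra_simps)

locale proper_lsc_gen_geodesically_convex = gen_geodesically_convex +
  assumes proper: "proper_P2 H" and lsc: "lsc_W2 H"
begin

text \<open>Allows real arithmetic with \<open>H\<close>. Only its values on
  \<open>dom_P2 H\<close>, where \<open>H\<close> is finite, are used.\<close>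

definition h :: "'a measure \<Rightarrow> real" where
  "h \<mu> = real_of_ereal (H \<mu>)"

lemma H_eq_h: "\<mu> \<in> dom_P2 H \<Longrightarrow> H \<mu> = ereal (h \<mu>)"
  using proper by (auto simp: h_def dom_P2_def proper_P2_def ereal_real)

lemma dom_imp_P2: "\<mu> \<in> dom_P2 H \<Longrightarrow> \<mu> \<in> P2"
  by (simp add: dom_P2_def)

lemma dom_P2I:
  fixes \<mu> :: "'a measure"
  assumes "\<mu> \<in> P2" "H \<mu> \<le> ereal r"
  shows "\<mu> \<in> dom_P2 H" "h \<mu> \<le> r"
proof -
  show dom: "\<mu> \<in> dom_P2 H"
    using assms by (auto simp: dom_P2_def intro: order.strict_trans1)
  show "h \<mu> \<le> r"
    using assms(2) H_eq_h[OF dom] by simp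
qed

text \<open>\<open>m\<close> is the point at time \<open>s\<close> of a generalized geodesic with
  base \<open>\<rho>\<close>. Integrating \<open>norm_convex_combination_sq\<close> gives the
  distance bound: the two costs to the base are optimal and hence exact. The cost between the end
  points may exceed \<open>W2 \<mu>0 \<mu>1\<close>, which is the favourable direction because it
  enters with a negative sign.\<close>

lemma interpolation:
  fixes \<rho> \<mu>0 \<mu>1 :: "'a measure"
  assumes "\<rho> \<in> P2" and dom: "\<mu>0 \<in> dom_P2 H" "\<mu>1 \<in> dom_P2 H" and s: "s \<in> {0..1}"
  obtains m where "m \<in> dom_P2 H" "h m \<le> (1 - s) * h \<mu>0 + s * h \<mu>1"
    "(W2 \<rho> m)\<^sup>2 \<le> (1 - s) * (W2 \<rho> \<mu>0)\<^sup>2 + s * (W2 \<rho> \<mu>1)\<^sup>2 - s * (1 - s) * (W2 \<mu>0 \<mu>1)\<^sup>2"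
proof (rule convex_three_plan[OF \<open>\<rho> \<in> P2\<close> dom[THEN dom_imp_P2]])
  fix M :: "('a \<times> 'a \<times> 'a) measure" and X Y Z
  assume M: "prob_space M"
    and meas [measurable]: "X \<in> borel_measurable M" "Y \<in> borel_measurable M" "Z \<in> borel_measurable M"
    and distr: "distr M borel X = \<rho>" "distr M borel Y = \<mu>0" "distr M borel Z = \<mu>1"
    and W: "(W2 \<rho> \<mu>0)\<^sup>2 = (\<integral>\<omega>. (norm (X \<omega> - Y \<omega>))\<^sup>2 \<partial>M)"
      "(W2 \<rho> \<mu>1)\<^sup>2 = (\<integral>\<omega>. (norm (X \<omega> - Z \<omega>))\<^sup>2 \<partial>M)"
    and convex: "\<And>s. s \<in> {0..1} \<Longrightarrow> H (distr M borel (\<lambda>\<omega>. (1 - s) *\<^sub>R Y \<omega> + s *\<^sub>R Z \<omega>)) \<le>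
      ereal (1 - s) * H \<mu>0 + ereal s * H \<mu>1"
  let ?V = "\<lambda>\<omega>. (1 - s) *\<^sub>R Y \<omega> + s *\<^sub>R Z \<omega>"
  have int: "integrable M (\<lambda>\<omega>. (norm (X \<omega>))\<^sup>2)" "integrable M (\<lambda>\<omega>. (norm (Y \<omega>))\<^sup>2)"
    "integrable M (\<lambda>\<omega>. (norm (Z \<omega>))\<^sup>2)"
    using assms(1) dom[THEN dom_imp_P2] M by (simp_all add: distr_in_P2_iff[symmetric] distr)
  have V: "integrable M (\<lambda>\<omega>. (norm (?V \<omega>))\<^sup>2)"
    by (intro integrable_norm_sq_add integrable_norm_sq_scaleR int) simp_all
  have diffs: "integrable M (\<lambda>\<omega>. (norm (X \<omega> - Y \<omega>))\<^sup>2)" "integrable M (\<lambda>\<omega>. (norm (X \<omega> - Z \<omega>))\<^sup>2)"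
    "integrable M (\<lambda>\<omega>. (norm (Y \<omega> - Z \<omega>))\<^sup>2)" "integrable M (\<lambda>\<omega>. (norm (X \<omega> - ?V \<omega>))\<^sup>2)"
    using int V by (auto intro!: integrable_norm_sq_diff)
  have "distr M borel ?V \<in> P2"
    using M V by (simp add: distr_in_P2_iff)
  moreover have "H (distr M borel ?V) \<le> ereal ((1 - s) * h \<mu>0 + s * h \<mu>1)"
    using convex[OF s] by (simp add: H_eq_h dom)
  ultimately have "distr M borel ?V \<in> dom_P2 H" "h (distr M borel ?V) \<le> (1 - s) * h \<mu>0 + s * h \<mu>1"
    by (rule dom_P2I)+
  moreover have "(W2 \<rho> (distr M borel ?V))\<^sup>2 \<le>
    (1 - s) * (W2 \<rho> \<mu>0)\<^sup>2 + s * (W2 \<rho> \<mu>1)\<^sup>2 - s * (1 - s) * (W2 \<mu>0 \<mu>1)\<^sup>2"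
  proof -
    have "(W2 \<rho> (distr M borel ?V))\<^sup>2 \<le> (\<integral>\<omega>. (norm (X \<omega> - ?V \<omega>))\<^sup>2 \<partial>M)"
      unfolding distr(1)[symmetric] by (intro W2_sq_le M diffs) simp_all
    also have "\<dots> = (\<integral>\<omega>. (1 - s) * (norm (X \<omega> - Y \<omega>))\<^sup>2 + s * (norm (X \<omega> - Z \<omega>))\<^sup>2
        - s * (1 - s) * (norm (Y \<omega> - Z \<omega>))\<^sup>2 \<partial>M)"
      by (intro Bochner_Integration.integral_cong refl, subst norm_minus_commute) (rule norm_convex_combination_sq)
    also have "\<dots> = (1 - s) * (W2 \<rho> \<mu>0)\<^sup>2 + s * (W2 \<rho> \<mu>1)\<^sup>2 - s * (1 - s) * (\<integral>\<omega>. (norm (Y \<omega> - Z \<omega>))\<^sup>2 \<partial>M)"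
      using diffs by (simp add: W)
    also have "\<dots> \<le> (1 - s) * (W2 \<rho> \<mu>0)\<^sup>2 + s * (W2 \<rho> \<mu>1)\<^sup>2 - s * (1 - s) * (W2 \<mu>0 \<mu>1)\<^sup>2"
      unfolding distr(2,3)[symmetric] using s
      by (intro diff_left_mono mult_left_mono W2_sq_le M diffs) simp_all
    finally show ?thesis .
  qed
  ultimately show thesis
    by (rule that)
qed

text \<open>Lower semicontinuity bounds \<open>h\<close> from below on a small ball around a point
  of the domain. Convexity along curves leaving the centre carries this bound to distant measures
  with a loss linear in the distance.\<close>

lemma linear_lower_bound:
  obtains \<mu>' a b where "\<mu>' \<in> P2" "b \<ge> 0" "\<And>\<nu>. \<nu> \<in> dom_P2 H \<Longrightarrow> a - b * W2 \<mu>' \<nu> \<le> h \<nu>"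
proof -
  obtain \<mu>' where \<mu>': "\<mu>' \<in> dom_P2 H"
    using proper by (auto simp: proper_P2_def)
  have "ereal (h \<mu>' - 1) < H \<mu>'"
    using \<mu>' by (simp add: H_eq_h)
  then obtain \<delta> where "\<delta> > 0"
    and \<delta>: "\<And>\<nu>. \<nu> \<in> P2 \<Longrightarrow> W2 \<mu>' \<nu> < \<delta> \<Longrightarrow> ereal (h \<mu>' - 1) < H \<nu>"
    using lsc dom_imp_P2[OF \<mu>'] unfolding lsc_W2_def by blast
  have near: "h \<mu>' - 1 \<le> h \<nu>" if "\<nu> \<in> dom_P2 H" "W2 \<mu>' \<nu> < \<delta>" for \<nu>
    using \<delta>[OF dom_imp_P2[OF that(1)] that(2)] that(1) by (simp add: H_eq_h)
  have "h \<mu>' - 1 - 2 / \<delta> * W2 \<mu>' \<nu> \<le> h \<nu>" if \<nu>: "\<nu> \<in> dom_P2 H" for \<nu>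
  proof (cases "W2 \<mu>' \<nu> < \<delta>")
    case True
    then have "h \<mu>' - 1 \<le> h \<nu>"
      using near \<nu> by blast
    moreover have "0 \<le> 2 / \<delta> * W2 \<mu>' \<nu>"
      using \<open>\<delta> > 0\<close> W2_nonneg[of \<mu>' \<nu>] by simp
    ultimately show ?thesis
      by linarith
  next
    case False
    define w where "w = W2 \<mu>' \<nu>"
    \<comment> \<open>Time \<open>s\<close> is chosen so that the curve from \<open>\<mu>'\<close>
      to \<open>\<nu>\<close> is at distance at most \<open>s * w = \<delta> / 2\<close> from
      \<open>\<mu>'\<close>, inside the ball.\<close>
    define s where "s = \<delta> / (2 * w)"
    have "\<delta> \<le> w" "0 < w"
      using False \<open>\<delta> > 0\<close> by (auto simp: w_def)
    then have s: "s \<in> {0..1}" "0 < s" "s * w < \<delta>"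
      using \<open>\<delta> > 0\<close> by (auto simp: s_def field_simps)
    obtain m where m: "m \<in> dom_P2 H" "h m \<le> (1 - s) * h \<mu>' + s * h \<nu>"
      "(W2 \<mu>' m)\<^sup>2 \<le> (1 - s) * (W2 \<mu>' \<mu>')\<^sup>2 + s * w\<^sup>2 - s * (1 - s) * w\<^sup>2"
      using interpolation[OF dom_imp_P2[OF \<mu>'] \<mu>' \<nu> s(1)] unfolding w_def by metis
    \<comment> \<open>Since the base is also the starting point, the bound collapses:
      \<open>s * w\<^sup>2 - s * (1 - s) * w\<^sup>2 = (s * w)\<^sup>2\<close>.\<close>
    have "(W2 \<mu>' m)\<^sup>2 \<le> (s * w)\<^sup>2"
      using m(3) W2_self[OF dom_imp_P2[OF \<mu>']] by (simp add: power2_eq_square algebra_simps)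
    then have "W2 \<mu>' m < \<delta>"
      using s \<open>0 < w\<close> power2_le_imp_le[of "W2 \<mu>' m" "s * w"] by simp
    then have "h \<mu>' - 1 \<le> (1 - s) * h \<mu>' + s * h \<nu>"
      using near[OF m(1)] m(2) by linarith
    then have "s * (h \<mu>' - 1 / s) \<le> s * h \<nu>"
      using s by (simp add: algebra_simps)
    then have "h \<mu>' - 1 / s \<le> h \<nu>"
      using s by simp
    moreover have "1 / s = 2 / \<delta> * W2 \<mu>' \<nu>"
      by (simp add: s_def w_def)
    ultimately show ?thesis
      by linarith
  qed
  then show thesis
    using that[of \<mu>' "2 / \<delta>" "h \<mu>' - 1"] dom_imp_P2[OF \<mu>'] \<open>\<delta> > 0\<close> by simp
qed

text \<open>The direct method with completeness in place of compactness: strong convexity of the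
  penalized functional makes a fast minimizing sequence Cauchy, and lower semicontinuity shows that
  its limit attains the infimum.\<close>

lemma prox_minimizer_exists:
  fixes \<rho> :: "'a measure"
  assumes \<rho>: "\<rho> \<in> P2" and "c > 0"
  obtains \<mu> where "\<mu> \<in> dom_P2 H" "\<And>\<nu>. \<nu> \<in> dom_P2 H \<Longrightarrow> h \<mu> + c * (W2 \<rho> \<mu>)\<^sup>2 \<le> h \<nu> + c * (W2 \<rho> \<nu>)\<^sup>2"
proof -
  define \<phi> where "\<phi> \<nu> = h \<nu> + c * (W2 \<rho> \<nu>)\<^sup>2" for \<nu>
  obtain \<mu>' a b where \<mu>': "\<mu>' \<in> P2" and "b \<ge> 0" and lower: "\<And>\<nu>. \<nu> \<in> dom_P2 H \<Longrightarrow> a - b * W2 \<mu>' \<nu> \<le> h \<nu>"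
    by (rule linear_lower_bound) blast
  \<comment> \<open>The quadratic penalty absorbs the linear decay of \<open>h\<close>, by
    completing the square.\<close>
  have "a - b * W2 \<mu>' \<rho> - b\<^sup>2 / (4 * c) \<le> \<phi> \<nu>" if \<nu>: "\<nu> \<in> dom_P2 H" for \<nu>
  proof -
    have "b * W2 \<mu>' \<nu> \<le> b * (W2 \<mu>' \<rho> + W2 \<rho> \<nu>)"
      using W2_triangle[OF \<mu>' \<rho> dom_imp_P2[OF \<nu>]] \<open>b \<ge> 0\<close> by (rule mult_left_mono)
    moreover have "0 \<le> (2 * c * W2 \<rho> \<nu> - b)\<^sup>2 / (4 * c)"
      using \<open>c > 0\<close> by simp
    then have "b * W2 \<rho> \<nu> - b\<^sup>2 / (4 * c) \<le> c * (W2 \<rho> \<nu>)\<^sup>2"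
      using \<open>c > 0\<close> by (simp add: power2_eq_square field_simps)
    ultimately show ?thesis
      using lower[OF \<nu>] unfolding \<phi>_def by (simp add: algebra_simps)
  qed
  then have bdd: "bdd_below (\<phi> ` dom_P2 H)"
    by (intro bdd_belowI2)
  define i where "i = Inf (\<phi> ` dom_P2 H)"
  have i_le: "i \<le> \<phi> \<nu>" if "\<nu> \<in> dom_P2 H" for \<nu>
    unfolding i_def using that by (intro cInf_lower[OF _ bdd]) simp
  \<comment> \<open>The rate \<open>1 / 4 ^ n\<close> is the one that
    \<open>W2_fast_Cauchy_convergent\<close> asks of squared distances.\<close>
  have "\<exists>\<nu>\<in>dom_P2 H. \<phi> \<nu> < i + 1 / 4 ^ n" for n
    using cInf_lessD[of "\<phi> ` dom_P2 H" "i + 1 / 4 ^ n"] proper by (auto simp: i_def proper_P2_def)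
  then obtain u where u: "\<And>n. u n \<in> dom_P2 H" and u_min: "\<And>n. \<phi> (u n) < i + 1 / 4 ^ n"
    by metis
  note uP2 = dom_imp_P2[OF u]
  \<comment> \<open>The value at the midpoint is at least the infimum \<open>i\<close>, so the
    strict convexity gain \<open>c / 4\<close> times the squared distance is at most the excess of
    the averaged values over \<open>i\<close>.\<close>
  have "(W2 (u n) (u (Suc n)))\<^sup>2 \<le> 4 / c / 4 ^ n" for n
  proof -
    obtain m where m: "m \<in> dom_P2 H" "h m \<le> (1 - 1 / 2) * h (u n) + 1 / 2 * h (u (Suc n))"
      "(W2 \<rho> m)\<^sup>2 \<le> (1 - 1 / 2) * (W2 \<rho> (u n))\<^sup>2 + 1 / 2 * (W2 \<rho> (u (Suc n)))\<^sup>2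
        - 1 / 2 * (1 - 1 / 2) * (W2 (u n) (u (Suc n)))\<^sup>2"
      using interpolation[OF \<rho> u[of n] u[of "Suc n"], of "1 / 2"] by auto
    have "i \<le> h m + c * (W2 \<rho> m)\<^sup>2"
      using i_le[OF m(1)] by (simp add: \<phi>_def)
    also have "\<dots> \<le> ((1 - 1 / 2) * h (u n) + 1 / 2 * h (u (Suc n))) + c * ((1 - 1 / 2) * (W2 \<rho> (u n))\<^sup>2 +
        1 / 2 * (W2 \<rho> (u (Suc n)))\<^sup>2 - 1 / 2 * (1 - 1 / 2) * (W2 (u n) (u (Suc n)))\<^sup>2)"
      using m \<open>c > 0\<close> by (intro add_mono mult_left_mono) auto
    also have "\<dots> = (\<phi> (u n) + \<phi> (u (Suc n))) / 2 - c * (W2 (u n) (u (Suc n)))\<^sup>2 / 4"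
      by (simp add: \<phi>_def algebra_simps add_divide_distrib)
    finally have "c * (W2 (u n) (u (Suc n)))\<^sup>2 / 4 \<le> (\<phi> (u n) + \<phi> (u (Suc n))) / 2 - i"
      by linarith
    moreover have "(\<phi> (u n) + \<phi> (u (Suc n))) / 2 - i \<le> 1 / 4 ^ n"
    proof -
      have "\<phi> (u (Suc n)) < i + 1 / 4 ^ n"
        using u_min[of "Suc n"] by (rule order.strict_trans2) (simp add: field_simps)
      then show ?thesis
        using u_min[of n] by (simp add: field_simps)
    qed
    ultimately have "c * (W2 (u n) (u (Suc n)))\<^sup>2 / 4 \<le> 1 / 4 ^ n"
      by (rule order_trans)
    then show ?thesis
      using \<open>c > 0\<close> by (simp add: field_simps)
  qed
  then obtain \<mu> where \<mu>: "\<mu> \<in> P2" and lim: "(\<lambda>n. W2 (u n) \<mu>) \<longlonglongrightarrow> 0"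
    using W2_fast_Cauchy_convergent[of u "4 / c"] uP2 \<open>c > 0\<close> by auto
  have lim_\<rho>: "(\<lambda>n. W2 \<rho> (u n)) \<longlonglongrightarrow> W2 \<rho> \<mu>"
  proof (rule LIM_zero_cancel, rule Lim_null_comparison[OF _ lim], rule always_eventually, rule allI)
    show "norm (W2 \<rho> (u n) - W2 \<rho> \<mu>) \<le> W2 (u n) \<mu>" for n
      using W2_triangle[OF \<rho> uP2[of n] \<mu>] W2_triangle[OF \<rho> \<mu> uP2[of n]] W2_commute[OF \<mu> uP2[of n]] by simp
  qed
  \<comment> \<open>Otherwise some real \<open>r\<close> separates the two sides. Lower
    semicontinuity puts \<open>h (u n)\<close> eventually above \<open>r\<close>, and the limit of
    the minimizing values contradicts the choice of \<open>r\<close>.\<close>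
  have "H \<mu> \<le> ereal (i - c * (W2 \<rho> \<mu>)\<^sup>2)"
  proof (rule ccontr)
    assume "\<not> H \<mu> \<le> ereal (i - c * (W2 \<rho> \<mu>)\<^sup>2)"
    then obtain r where r: "i - c * (W2 \<rho> \<mu>)\<^sup>2 < r" "ereal r < H \<mu>"
      using ereal_dense2[of "ereal (i - c * (W2 \<rho> \<mu>)\<^sup>2)" "H \<mu>"] by (auto simp: not_le)
    then obtain \<delta> where "\<delta> > 0" and \<delta>: "\<And>\<nu>. \<nu> \<in> P2 \<Longrightarrow> W2 \<mu> \<nu> < \<delta> \<Longrightarrow> ereal r < H \<nu>"
      using lsc \<mu> unfolding lsc_W2_def by blast
    have "\<forall>\<^sub>F n in sequentially. W2 (u n) \<mu> < \<delta>"
      using order_tendstoD(2)[OF lim \<open>\<delta> > 0\<close>] .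
    then have "\<forall>\<^sub>F n in sequentially. r + c * (W2 \<rho> (u n))\<^sup>2 \<le> i + 1 / 4 ^ n"
    proof eventually_elim
      case (elim n)
      then have "r < h (u n)"
        using \<delta>[OF uP2[of n]] W2_commute[OF \<mu> uP2[of n]] by (simp add: H_eq_h u)
      then show ?case
        using u_min[of n] by (simp add: \<phi>_def)
    qed
    moreover have "(\<lambda>n. r + c * (W2 \<rho> (u n))\<^sup>2) \<longlonglongrightarrow> r + c * (W2 \<rho> \<mu>)\<^sup>2"
      by (intro tendsto_intros lim_\<rho>)
    moreover have "(\<lambda>n. i + 1 / 4 ^ n) \<longlonglongrightarrow> i + 0"
      by (intro tendsto_intros LIMSEQ_divide_realpow_zero) simp
    ultimately have "r + c * (W2 \<rho> \<mu>)\<^sup>2 \<le> i + 0"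
      by (intro tendsto_le[OF sequentially_bot])
    then show False
      using r(1) by simp
  qed
  then have "\<mu> \<in> dom_P2 H" "h \<mu> \<le> i - c * (W2 \<rho> \<mu>)\<^sup>2"
    using dom_P2I[OF \<mu>] by auto
  then show thesis
    using that[of \<mu>] i_le by (force simp: \<phi>_def)
qed

text \<open>Existence of a minimizer makes the choice in \<open>arg_min_on\<close> meet its
  specification. Measures outside the domain have penalized value infinity, so the comparison can be
  made with real numbers.\<close>

lemma prox_W2_minimizes:
  fixes \<rho> :: "'a measure"
  assumes \<rho>: "\<rho> \<in> P2" and "\<tau> > 0"
  shows "prox_W2 \<tau> H \<rho> \<in> dom_P2 H"
    and "\<nu> \<in> dom_P2 H \<Longrightarrow> h (prox_W2 \<tau> H \<rho>) + 1 / (2 * \<tau>) * (W2 \<rho> (prox_W2 \<tau> H \<rho>))\<^sup>2 \<le> h \<nu> + 1 / (2 * \<tau>) * (W2 \<rho> \<nu>)\<^sup>2"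
proof -
  define f where "f \<nu> = H \<nu> + ereal (1 / (2 * \<tau>) * (W2 \<nu> \<rho>)\<^sup>2)" for \<nu>
  define J where "J = prox_W2 \<tau> H \<rho>"
  have f: "f \<nu> = ereal (h \<nu> + 1 / (2 * \<tau>) * (W2 \<rho> \<nu>)\<^sup>2)" if "\<nu> \<in> dom_P2 H" for \<nu>
    using that by (simp add: f_def H_eq_h W2_commute[OF dom_imp_P2 \<rho>])
  have f_top: "f \<nu> = \<infinity>" if "\<nu> \<in> P2" "\<nu> \<notin> dom_P2 H" for \<nu>
    using that by (simp add: f_def dom_P2_def)
  obtain \<mu> where \<mu>: "\<mu> \<in> dom_P2 H"
    and min: "\<And>\<nu>. \<nu> \<in> dom_P2 H \<Longrightarrow> h \<mu> + 1 / (2 * \<tau>) * (W2 \<rho> \<mu>)\<^sup>2 \<le> h \<nu> + 1 / (2 * \<tau>) * (W2 \<rho> \<nu>)\<^sup>2"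
    using prox_minimizer_exists[OF \<rho>, of "1 / (2 * \<tau>)"] \<open>\<tau> > 0\<close> by auto
  have "f \<mu> \<le> f \<nu>" if "\<nu> \<in> P2" for \<nu>
    using that f f_top \<mu> min by (cases "\<nu> \<in> dom_P2 H") simp_all
  then have "is_arg_min f (\<lambda>\<nu>. \<nu> \<in> P2) \<mu>"
    using dom_imp_P2[OF \<mu>] by (simp add: is_arg_min_linorder)
  then have "is_arg_min f (\<lambda>\<nu>. \<nu> \<in> P2) J"
    unfolding J_def prox_W2_def arg_min_on_def arg_min_def f_def[symmetric] by (rule someI)
  then have J: "J \<in> P2" "\<And>\<nu>. \<nu> \<in> P2 \<Longrightarrow> f J \<le> f \<nu>"
    by (simp_all add: is_arg_min_linorder)
  have "f J \<noteq> \<infinity>"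
    using J(2)[OF dom_imp_P2[OF \<mu>]] f[OF \<mu>] by auto
  then show dom: "prox_W2 \<tau> H \<rho> \<in> dom_P2 H"
    using f_top J(1) unfolding J_def by blast
  show "h (prox_W2 \<tau> H \<rho>) + 1 / (2 * \<tau>) * (W2 \<rho> (prox_W2 \<tau> H \<rho>))\<^sup>2 \<le> h \<nu> + 1 / (2 * \<tau>) * (W2 \<rho> \<nu>)\<^sup>2"
    if "\<nu> \<in> dom_P2 H"
    using J(2)[OF dom_imp_P2[OF that]] f that dom by (simp add: J_def)
qed

text \<open>The discrete evolution variational inequality: \<open>J\<close> is compared with the
  points on a generalized geodesic from \<open>J\<close> to \<open>\<nu>\<close> with base
  \<open>\<rho>\<close>, near its start.\<close>

lemma prox_W2_EVI:
  fixes \<rho> \<nu> :: "'a measure"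
  assumes \<rho>: "\<rho> \<in> P2" and "\<tau> > 0" and \<nu>: "\<nu> \<in> dom_P2 H"
  shows "(W2 (prox_W2 \<tau> H \<rho>) \<nu>)\<^sup>2 \<le> (W2 \<rho> \<nu>)\<^sup>2 - (W2 \<rho> (prox_W2 \<tau> H \<rho>))\<^sup>2 - 2 * \<tau> * (h (prox_W2 \<tau> H \<rho>) - h \<nu>)"
proof -
  define J where "J = prox_W2 \<tau> H \<rho>"
  define c where "c = 1 / (2 * \<tau>)"
  have "c > 0"
    using \<open>\<tau> > 0\<close> by (simp add: c_def)
  have J: "J \<in> dom_P2 H" "\<And>\<nu>. \<nu> \<in> dom_P2 H \<Longrightarrow> h J + c * (W2 \<rho> J)\<^sup>2 \<le> h \<nu> + c * (W2 \<rho> \<nu>)\<^sup>2"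
    unfolding J_def c_def using prox_W2_minimizes[OF \<rho> \<open>\<tau> > 0\<close>] by auto
  have "c * (W2 J \<nu>)\<^sup>2 \<le> (h \<nu> + c * (W2 \<rho> \<nu>)\<^sup>2) - (h J + c * (W2 \<rho> J)\<^sup>2)"
  \<comment> \<open>Dividing by \<open>s\<close> leaves the factor \<open>z = 1 - s\<close> on the
    left. Having the bound for every \<open>z\<close> between 0 and 1 replaces the limit
    \<open>s\<close> to 0.\<close>
  proof (rule field_le_mult_one_interval)
    fix z :: real assume z: "0 < z" "z < 1"
    define s where "s = 1 - z"
    have s: "s \<in> {0..1}" "0 < s" "z = 1 - s"
      using z by (auto simp: s_def)
    obtain m where m: "m \<in> dom_P2 H" "h m \<le> (1 - s) * h J + s * h \<nu>"
      "(W2 \<rho> m)\<^sup>2 \<le> (1 - s) * (W2 \<rho> J)\<^sup>2 + s * (W2 \<rho> \<nu>)\<^sup>2 - s * (1 - s) * (W2 J \<nu>)\<^sup>2"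
      using interpolation[OF \<rho> J(1) \<nu> s(1)] by metis
    have "h J + c * (W2 \<rho> J)\<^sup>2 \<le> h m + c * (W2 \<rho> m)\<^sup>2"
      using J(2)[OF m(1)] .
    also have "\<dots> \<le> ((1 - s) * h J + s * h \<nu>) + c * ((1 - s) * (W2 \<rho> J)\<^sup>2 + s * (W2 \<rho> \<nu>)\<^sup>2 - s * (1 - s) * (W2 J \<nu>)\<^sup>2)"
      using m \<open>c > 0\<close> by (intro add_mono mult_left_mono) auto
    finally have "s * (z * (c * (W2 J \<nu>)\<^sup>2)) \<le> s * ((h \<nu> + c * (W2 \<rho> \<nu>)\<^sup>2) - (h J + c * (W2 \<rho> J)\<^sup>2))"
      unfolding s(3) by (simp add: algebra_simps)
    then show "z * (c * (W2 J \<nu>)\<^sup>2) \<le> (h \<nu> + c * (W2 \<rho> \<nu>)\<^sup>2) - (h J + c * (W2 \<rho> J)\<^sup>2)"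
      using s(2) by simp
  qed
  then have "2 * \<tau> * (c * (W2 J \<nu>)\<^sup>2) \<le> 2 * \<tau> * ((h \<nu> + c * (W2 \<rho> \<nu>)\<^sup>2) - (h J + c * (W2 \<rho> J)\<^sup>2))"
    using \<open>\<tau> > 0\<close> by (intro mult_left_mono) auto
  then show ?thesis
    using \<open>\<tau> > 0\<close> unfolding J_def[symmetric] by (simp add: c_def algebra_simps)
qed

end

section \<open>The gradient step\<close>

lemma gderiv_along_line:
  fixes F :: "'a::real_inner \<Rightarrow> real"
  assumes "GDERIV F (x + t *\<^sub>R v) :> g"
  shows "((\<lambda>t. F (x + t *\<^sub>R v)) has_real_derivative g \<bullet> v) (at t)"
proof -
  have "(F has_derivative (\<lambda>h. h \<bullet> g)) (at (x + t *\<^sub>R v))"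
    using assms by (simp add: gderiv_def)
  then have "((\<lambda>t. F (x + t *\<^sub>R v)) has_derivative (\<lambda>s. (s *\<^sub>R v) \<bullet> g)) (at t)"
    by (rule has_derivative_compose[where f="\<lambda>t. x + t *\<^sub>R v", rotated])
      (auto intro!: derivative_eq_intros)
  then show ?thesis
    by (rule has_derivative_imp_has_field_derivative) (simp add: inner_commute)
qed

text \<open>Strong convexity on the segment from \<open>x\<close> to \<open>y\<close>, divided by
  \<open>t\<close>, bounds the difference quotient of \<open>F\<close>; then \<open>t\<close> tends
  to 0 from the right.\<close>

lemma gradient_inequality_strongly_convex:
  fixes F :: "'a::euclidean_space \<Rightarrow> real"
  assumes "strongly_convex lam F" and "GDERIV F x :> g"
  shows "F x + g \<bullet> (y - x) + lam / 2 * (norm (x - y))\<^sup>2 \<le> F y"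
proof -
  have "((\<lambda>t. F (x + t *\<^sub>R (y - x))) has_real_derivative g \<bullet> (y - x)) (at 0 within {0<..})"
    using assms(2) by (intro gderiv_along_line[THEN has_field_derivative_at_within]) simp
  then have "((\<lambda>t. (F (x + t *\<^sub>R (y - x)) - F x) / t) \<longlongrightarrow> g \<bullet> (y - x)) (at_right 0)"
    by (simp add: has_field_derivative_iff)
  moreover have "((\<lambda>t. F y - F x - lam / 2 * (1 - t) * (norm (x - y))\<^sup>2) \<longlongrightarrow>
      F y - F x - lam / 2 * (1 - 0) * (norm (x - y))\<^sup>2) (at_right 0)"
    by (intro tendsto_intros)
  moreover have "\<forall>\<^sub>F t in at_right 0. (F (x + t *\<^sub>R (y - x)) - F x) / t \<le> F y - F x - lam / 2 * (1 - t) * (norm (x - y))\<^sup>2"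
    unfolding eventually_at_right_field
  proof (intro exI[of _ 1] conjI allI impI)
    fix t :: real assume t: "0 < t" "t < 1"
    have "F (x + t *\<^sub>R (y - x)) = F ((1 - t) *\<^sub>R x + t *\<^sub>R y)"
      by (simp add: algebra_simps)
    also have "\<dots> \<le> (1 - t) * F x + t * F y - lam / 2 * t * (1 - t) * (norm (x - y))\<^sup>2"
      using assms(1) t unfolding strongly_convex_def by auto
    finally have "F (x + t *\<^sub>R (y - x)) - F x \<le> t * (F y - F x - lam / 2 * (1 - t) * (norm (x - y))\<^sup>2)"
      by (simp add: algebra_simps)
    then show "(F (x + t *\<^sub>R (y - x)) - F x) / t \<le> F y - F x - lam / 2 * (1 - t) * (norm (x - y))\<^sup>2"
      using t by (simp add: divide_le_eq mult.commute)
  qed simp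
  ultimately have "g \<bullet> (y - x) \<le> F y - F x - lam / 2 * (1 - 0) * (norm (x - y))\<^sup>2"
    by (intro tendsto_le[OF trivial_limit_at_right_real])
  then show ?thesis
    by simp
qed

text \<open>Along the segment, \<open>F\<close> minus the quadratic Taylor bound has nonpositive
  derivative, by Cauchy-Schwarz and the Lipschitz bound; comparing its values at 0 and 1 gives the
  claim.\<close>

lemma descent_lemma:
  fixes F :: "'a::euclidean_space \<Rightarrow> real"
  assumes deriv: "\<And>x. GDERIV F x :> gradF x" and lip: "L-lipschitz_on UNIV gradF"
  shows "F y \<le> F x + gradF x \<bullet> (y - x) + L / 2 * (norm (x - y))\<^sup>2"
proof -
  define \<phi> where "\<phi> t = F (x + t *\<^sub>R (y - x)) - t * (gradF x \<bullet> (y - x)) - L / 2 * t\<^sup>2 * (norm (x - y))\<^sup>2" for t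
  have "(\<phi> has_real_derivative
      gradF (x + t *\<^sub>R (y - x)) \<bullet> (y - x) - gradF x \<bullet> (y - x) - L * t * (norm (x - y))\<^sup>2) (at t)" for t
    unfolding \<phi>_def by (auto intro!: derivative_eq_intros gderiv_along_line deriv)
  moreover have "gradF (x + t *\<^sub>R (y - x)) \<bullet> (y - x) - gradF x \<bullet> (y - x) - L * t * (norm (x - y))\<^sup>2 \<le> 0"
    if "0 \<le> t" for t
  proof -
    have "(gradF (x + t *\<^sub>R (y - x)) - gradF x) \<bullet> (y - x) \<le> norm (gradF (x + t *\<^sub>R (y - x)) - gradF x) * norm (y - x)"
      by (rule norm_cauchy_schwarz)
    also have "\<dots> \<le> (L * norm (t *\<^sub>R (y - x))) * norm (y - x)"
      using lipschitz_onD[OF lip, of "x + t *\<^sub>R (y - x)" x] by (intro mult_right_mono) (simp_all add: dist_norm)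
    also have "\<dots> = L * t * (norm (x - y))\<^sup>2"
      using that by (simp add: power2_eq_square norm_minus_commute)
    finally show ?thesis
      by (simp add: inner_diff_left)
  qed
  ultimately have "\<phi> 1 \<le> \<phi> 0"
    by (intro DERIV_nonpos_imp_nonincreasing[of 0 1]) fastforce+
  then show ?thesis
    by (simp add: \<phi>_def)
qed

text \<open>Solving \<open>x - \<tau> *\<^sub>R G x = y\<close> is a fixed point problem for a
  contraction. The step stretches distances by at least \<open>1 - \<tau> * L\<close>, so it is
  injective and its inverse is Lipschitz.\<close>

lemma gradient_step_inverse:
  fixes G :: "'a::euclidean_space \<Rightarrow> 'a"
  assumes lip: "L-lipschitz_on UNIV G" and "0 < \<tau>" "\<tau> * L < 1"
  obtains S where "continuous_on UNIV S" "\<And>x. S (x - \<tau> *\<^sub>R G x) = x" "\<And>y. S y - \<tau> *\<^sub>R G (S y) = y"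
proof -
  define T where "T x = x - \<tau> *\<^sub>R G x" for x
  have lip': "norm (\<tau> *\<^sub>R G x - \<tau> *\<^sub>R G x') \<le> \<tau> * L * norm (x - x')" for x x'
  proof -
    have "norm (\<tau> *\<^sub>R G x - \<tau> *\<^sub>R G x') = \<tau> * norm (G x - G x')"
      using \<open>0 < \<tau>\<close> by (simp flip: scaleR_diff_right)
    also have "\<dots> \<le> \<tau> * (L * norm (x - x'))"
      using lipschitz_onD[OF lip, of x x'] \<open>0 < \<tau>\<close> by (intro mult_left_mono) (auto simp: dist_norm)
    finally show ?thesis
      by simp
  qed
  have expand: "(1 - \<tau> * L) * norm (x - x') \<le> norm (T x - T x')" for x x'
    using norm_triangle_ineq2[of "x - x'" "\<tau> *\<^sub>R G x - \<tau> *\<^sub>R G x'"] lip'[of x x']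
    by (simp add: T_def algebra_simps)
  have surj: "\<exists>x. T x = y" for y
  proof -
    have "0 \<le> \<tau> * L"
      using lipschitz_on_nonneg[OF lip] \<open>0 < \<tau>\<close> by simp
    then have "\<exists>!x. y + \<tau> *\<^sub>R G x = x"
      using lip' \<open>\<tau> * L < 1\<close> by (intro banach_fix_type[of "\<tau> * L"]) (auto simp: dist_norm)
    then obtain x where "y + \<tau> *\<^sub>R G x = x"
      by blast
    then show ?thesis
      by (metis T_def add_diff_cancel_right')
  qed
  then obtain S where S: "\<And>y. T (S y) = y"
    by metis
  have S': "S (T x) = x" for x
    using expand[of "S (T x)" x] S[of "T x"] \<open>\<tau> * L < 1\<close> by (simp add: mult_le_0_iff)
  have "(1 / (1 - \<tau> * L))-lipschitz_on UNIV S"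
  proof (rule lipschitz_onI)
    fix y y'
    have "(1 - \<tau> * L) * norm (S y - S y') \<le> norm (y - y')"
      using expand[of "S y" "S y'"] by (simp add: S)
    then show "dist (S y) (S y') \<le> 1 / (1 - \<tau> * L) * dist y y'"
      using \<open>\<tau> * L < 1\<close> by (simp add: dist_norm pos_le_divide_eq mult.commute)
  qed (use \<open>\<tau> * L < 1\<close> in simp)
  then have "continuous_on UNIV S"
    by (rule lipschitz_on_continuous_on)
  then show thesis
    using that[of S] S S' by (simp add: T_def)
qed

section \<open>Integrability and expansion for smooth strongly convex potentials\<close>

locale smooth_strongly_convex =
  fixes F :: "'a::euclidean_space \<Rightarrow> real" and gradF :: "'a \<Rightarrow> 'a" and L lam :: real
  assumes deriv: "\<And>x. GDERIV F x :> gradF x"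
    and lip: "L-lipschitz_on UNIV gradF"
    and strongly_convex: "strongly_convex lam F" and lam_nonneg: "lam \<ge> 0"
begin

lemma F_measurable [measurable]: "F \<in> borel_measurable borel"
proof (rule borel_measurable_continuous_onI)
  show "continuous_on UNIV F"
    using deriv unfolding gderiv_def
    by (intro continuous_at_imp_continuous_on ballI) (rule has_derivative_continuous)
qed

lemma gradF_measurable [measurable]: "gradF \<in> borel_measurable borel"
  by (intro borel_measurable_continuous_onI lipschitz_on_continuous_on[OF lip])

lemma quadratic_upper_bound: "F y \<le> F x + gradF x \<bullet> (y - x) + L / 2 * (norm (x - y))\<^sup>2"
  using descent_lemma[OF deriv lip] .

lemma quadratic_lower_bound: "F x + gradF x \<bullet> (y - x) + lam / 2 * (norm (x - y))\<^sup>2 \<le> F y"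
  using gradient_inequality_strongly_convex[OF strongly_convex deriv] .

lemma integrable_gradF_sq:
  assumes M: "prob_space M" and [measurable]: "X \<in> borel_measurable M"
    and X: "integrable M (\<lambda>\<omega>. (norm (X \<omega>))\<^sup>2)"
  shows "integrable M (\<lambda>\<omega>. (norm (gradF (X \<omega>)))\<^sup>2)"
proof (rule Bochner_Integration.integrable_bound)
  interpret prob_space M by fact
  show "integrable M (\<lambda>\<omega>. 2 * (norm (gradF 0))\<^sup>2 + 2 * (L\<^sup>2 * (norm (X \<omega>))\<^sup>2))"
    using X by simp
  have "(norm (gradF (X \<omega>)))\<^sup>2 \<le> 2 * (norm (gradF 0))\<^sup>2 + 2 * (L\<^sup>2 * (norm (X \<omega>))\<^sup>2)" for \<omega>
  proof -
    have "norm (gradF (X \<omega>) - gradF 0) \<le> L * norm (X \<omega>)"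
      using lipschitz_onD[OF lip, of "X \<omega>" 0] by (simp add: dist_norm)
    then have "(norm (gradF (X \<omega>) - gradF 0))\<^sup>2 \<le> (L * norm (X \<omega>))\<^sup>2"
      by (intro power_mono) simp_all
    then show ?thesis
      using norm_add_sq_le[of "gradF 0" "gradF (X \<omega>) - gradF 0"] by (simp add: power_mult_distrib)
  qed
  then show "AE \<omega> in M. norm ((norm (gradF (X \<omega>)))\<^sup>2) \<le> norm (2 * (norm (gradF 0))\<^sup>2 + 2 * (L\<^sup>2 * (norm (X \<omega>))\<^sup>2))"
    by (intro AE_I2) simp
qed simp

text \<open>At the origin \<open>F\<close> has an affine minorant and a quadratic majorant, so it
  grows at most quadratically.\<close>

lemma integrable_F:
  assumes M: "prob_space M" and [measurable]: "X \<in> borel_measurable M"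
    and X: "integrable M (\<lambda>\<omega>. (norm (X \<omega>))\<^sup>2)"
  shows "integrable M (\<lambda>\<omega>. F (X \<omega>))"
proof (rule Bochner_Integration.integrable_bound)
  interpret prob_space M by fact
  define g where "g = gradF 0"
  have "L \<ge> 0"
    using lip by (rule lipschitz_on_nonneg)
  show "integrable M (\<lambda>\<omega>. \<bar>F 0\<bar> + (norm g)\<^sup>2 + (1 + L / 2) * (norm (X \<omega>))\<^sup>2)"
    using X by simp
  have "\<bar>F x\<bar> \<le> \<bar>F 0\<bar> + (norm g)\<^sup>2 + (1 + L / 2) * (norm x)\<^sup>2" for x
  proof -
    have "\<bar>g \<bullet> x\<bar> \<le> norm g * norm x"
      by (rule Cauchy_Schwarz_ineq2)
    also have "\<dots> \<le> (norm g)\<^sup>2 + (norm x)\<^sup>2"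
      using sum_squares_bound[of "norm g" "norm x"] zero_le_power2[of "norm g"] zero_le_power2[of "norm x"] by linarith
    finally have "\<bar>g \<bullet> x\<bar> \<le> (norm g)\<^sup>2 + (norm x)\<^sup>2" .
    moreover have "F x \<le> F 0 + g \<bullet> x + L / 2 * (norm x)\<^sup>2"
      using quadratic_upper_bound[of x 0] by (simp add: g_def)
    moreover have "F 0 + g \<bullet> x + lam / 2 * (norm x)\<^sup>2 \<le> F x"
      using quadratic_lower_bound[of 0 x] by (simp add: g_def)
    moreover have "0 \<le> lam / 2 * (norm x)\<^sup>2" "0 \<le> L / 2 * (norm x)\<^sup>2"
      using lam_nonneg \<open>L \<ge> 0\<close> by simp_all
    moreover have "(1 + L / 2) * (norm x)\<^sup>2 = (norm x)\<^sup>2 + L / 2 * (norm x)\<^sup>2"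
      by (simp add: algebra_simps)
    ultimately show ?thesis
      by linarith
  qed
  then show "AE \<omega> in M. norm (F (X \<omega>)) \<le> norm (\<bar>F 0\<bar> + (norm g)\<^sup>2 + (1 + L / 2) * (norm (X \<omega>))\<^sup>2)"
    using \<open>L \<ge> 0\<close> by (intro AE_I2) simp
qed simp

lemma gradient_step_in_P2:
  assumes "\<mu> \<in> P2"
  shows "distr \<mu> borel (\<lambda>x. x - \<tau> *\<^sub>R gradF x) \<in> P2"
proof -
  have cong: "measurable \<mu> N = measurable borel N" for N :: "'a measure"
    by (rule measurable_cong_sets[OF P2_sets[OF assms] refl])
  have [measurable]: "(\<lambda>x. x) \<in> borel_measurable \<mu>" "gradF \<in> borel_measurable \<mu>"
    by (simp_all add: cong)
  have "integrable \<mu> (\<lambda>x. (norm (x - \<tau> *\<^sub>R gradF x))\<^sup>2)"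
    by (intro integrable_norm_sq_diff integrable_norm_sq_scaleR integrable_gradF_sq[where X="\<lambda>x. x"]
        P2_integrable P2_prob_space assms) simp_all
  then show ?thesis
    by (simp add: distr_in_P2_iff P2_prob_space assms)
qed

text \<open>Shared by the upper and lower bounds below: the inner product is the first-order Taylor
  term of \<open>F\<close>, and the squared gradient is kept exactly so that it cancels when the
  bounds are combined.\<close>

lemma expand_gradient_step:
  "(norm (x - \<tau> *\<^sub>R gradF x - y))\<^sup>2 =
    (norm (x - y))\<^sup>2 + 2 * \<tau> * (gradF x \<bullet> (y - x)) + \<tau>\<^sup>2 * (norm (gradF x))\<^sup>2"
  unfolding power2_norm_eq_inner power2_eq_square[of \<tau>]
  by (simp add: inner_simps inner_commute algebra_simps)

end

section \<open>Effect of the gradient step on the Wasserstein distance\<close>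

context gen_geodesically_convex
begin

text \<open>Applying the step to the first variable of an optimal plan for \<open>\<mu>\<close> and
  \<open>\<nu>\<close> gives a competitor. Its cost is expanded, and the inner product is bounded
  above by strong convexity.\<close>

lemma W2_gradient_step_upper:
  fixes \<mu> \<nu> :: "'a measure"
  assumes "smooth_strongly_convex F gradF L lam" and "\<tau> > 0" and \<mu>: "\<mu> \<in> P2" and \<nu>: "\<nu> \<in> P2"
  shows "(W2 (distr \<mu> borel (\<lambda>x. x - \<tau> *\<^sub>R gradF x)) \<nu>)\<^sup>2 \<le>
    (1 - \<tau> * lam) * (W2 \<mu> \<nu>)\<^sup>2 - 2 * \<tau> * ((\<integral>x. F x \<partial>\<mu>) - (\<integral>x. F x \<partial>\<nu>)) + \<tau>\<^sup>2 * (\<integral>x. (norm (gradF x))\<^sup>2 \<partial>\<mu>)"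
proof (rule optimal_coupling[OF \<mu> \<nu>])
  interpret F: smooth_strongly_convex F gradF L lam by fact
  fix M :: "('a \<times> 'a \<times> 'a) measure" and X Y
  assume M: "prob_space M" and [measurable]: "X \<in> borel_measurable M" "Y \<in> borel_measurable M"
    and distr: "distr M borel X = \<mu>" "distr M borel Y = \<nu>"
    and sq: "integrable M (\<lambda>\<omega>. (norm (X \<omega>))\<^sup>2)" "integrable M (\<lambda>\<omega>. (norm (Y \<omega>))\<^sup>2)"
    and W: "(W2 \<mu> \<nu>)\<^sup>2 = (\<integral>\<omega>. (norm (X \<omega> - Y \<omega>))\<^sup>2 \<partial>M)"
  let ?T = "\<lambda>x. x - \<tau> *\<^sub>R gradF x"
  have eqs: "(\<integral>x. F x \<partial>\<mu>) = (\<integral>\<omega>. F (X \<omega>) \<partial>M)" "(\<integral>x. F x \<partial>\<nu>) = (\<integral>\<omega>. F (Y \<omega>) \<partial>M)"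
    "(\<integral>x. (norm (gradF x))\<^sup>2 \<partial>\<mu>) = (\<integral>\<omega>. (norm (gradF (X \<omega>)))\<^sup>2 \<partial>M)"
    unfolding distr[symmetric] by (simp_all add: integral_distr)
  note int = sq F.integrable_F[OF M _ sq(1)] F.integrable_F[OF M _ sq(2)] F.integrable_gradF_sq[OF M _ sq(1)]
  have diff: "integrable M (\<lambda>\<omega>. (norm (X \<omega> - Y \<omega>))\<^sup>2)"
    by (intro integrable_norm_sq_diff sq) simp_all
  have T: "integrable M (\<lambda>\<omega>. (norm (?T (X \<omega>) - Y \<omega>))\<^sup>2)"
    by (intro integrable_norm_sq_diff integrable_norm_sq_scaleR int) simp_all
  have "distr \<mu> borel ?T = distr M borel (\<lambda>\<omega>. ?T (X \<omega>))"
    unfolding distr(1)[symmetric] by (subst distr_distr) (simp_all add: comp_def)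
  then have "(W2 (distr \<mu> borel ?T) \<nu>)\<^sup>2 \<le> (\<integral>\<omega>. (norm (?T (X \<omega>) - Y \<omega>))\<^sup>2 \<partial>M)"
    unfolding distr(2)[symmetric] using W2_sq_le[OF M _ _ T] by simp
  also have "\<dots> \<le> (\<integral>\<omega>. (1 - \<tau> * lam) * (norm (X \<omega> - Y \<omega>))\<^sup>2 - 2 * \<tau> * (F (X \<omega>) - F (Y \<omega>))
      + \<tau>\<^sup>2 * (norm (gradF (X \<omega>)))\<^sup>2 \<partial>M)"
  proof (rule integral_mono[OF T])
    show "integrable M (\<lambda>\<omega>. (1 - \<tau> * lam) * (norm (X \<omega> - Y \<omega>))\<^sup>2 - 2 * \<tau> * (F (X \<omega>) - F (Y \<omega>))
      + \<tau>\<^sup>2 * (norm (gradF (X \<omega>)))\<^sup>2)"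
      using int diff by simp
    fix \<omega>
    have "2 * \<tau> * (F (X \<omega>) + gradF (X \<omega>) \<bullet> (Y \<omega> - X \<omega>) + lam / 2 * (norm (X \<omega> - Y \<omega>))\<^sup>2) \<le> 2 * \<tau> * F (Y \<omega>)"
      using F.quadratic_lower_bound[of "X \<omega>" "Y \<omega>"] \<open>\<tau> > 0\<close> by (intro mult_left_mono) simp_all
    then show "(norm (?T (X \<omega>) - Y \<omega>))\<^sup>2 \<le> (1 - \<tau> * lam) * (norm (X \<omega> - Y \<omega>))\<^sup>2 - 2 * \<tau> * (F (X \<omega>) - F (Y \<omega>))
        + \<tau>\<^sup>2 * (norm (gradF (X \<omega>)))\<^sup>2"
      unfolding F.expand_gradient_step by (simp add: algebra_simps)
  qed
  also have "\<dots> = (1 - \<tau> * lam) * (W2 \<mu> \<nu>)\<^sup>2 - 2 * \<tau> * ((\<integral>x. F x \<partial>\<mu>) - (\<integral>x. F x \<partial>\<nu>)) + \<tau>\<^sup>2 * (\<integral>x. (norm (gradF x))\<^sup>2 \<partial>\<mu>)"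
    using int diff by (simp add: W eqs)
  finally show ?thesis .
qed

text \<open>An optimal plan for the image measure and \<open>\<nu>\<close> is pulled back to a
  coupling of \<open>\<mu>\<close> and \<open>\<nu>\<close>. Expanding its cost and bounding the
  inner product below by smoothness leaves the coefficient \<open>1 - \<tau> * L\<close> on the
  pulled-back cost, whose sign permits replacing that cost by the squared distance.\<close>

lemma W2_gradient_step_lower:
  fixes \<mu> \<nu> :: "'a measure"
  assumes "smooth_strongly_convex F gradF L lam" and "\<tau> > 0" "\<tau> * L < 1" and \<mu>: "\<mu> \<in> P2" and \<nu>: "\<nu> \<in> P2"
  shows "(1 - \<tau> * L) * (W2 \<mu> \<nu>)\<^sup>2 + 2 * \<tau> * ((\<integral>x. F x \<partial>\<nu>) - (\<integral>x. F x \<partial>\<mu>)) + \<tau>\<^sup>2 * (\<integral>x. (norm (gradF x))\<^sup>2 \<partial>\<mu>) \<le>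
    (W2 (distr \<mu> borel (\<lambda>x. x - \<tau> *\<^sub>R gradF x)) \<nu>)\<^sup>2"
proof -
  interpret F: smooth_strongly_convex F gradF L lam by fact
  let ?T = "\<lambda>x. x - \<tau> *\<^sub>R gradF x"
  obtain S where "continuous_on UNIV S" and ST: "\<And>x. S (?T x) = x" and TS: "\<And>y. ?T (S y) = y"
    by (rule gradient_step_inverse[OF F.lip \<open>\<tau> > 0\<close> \<open>\<tau> * L < 1\<close>]) blast
  then have [measurable]: "S \<in> borel_measurable borel"
    by (intro borel_measurable_continuous_onI)
  show ?thesis
  proof (rule optimal_coupling[OF F.gradient_step_in_P2[OF \<mu>, of \<tau>] \<nu>])
    fix M :: "('a \<times> 'a \<times> 'a) measure" and X Y
    assume M: "prob_space M" and [measurable]: "X \<in> borel_measurable M" "Y \<in> borel_measurable M"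
      and distr: "distr M borel X = distr \<mu> borel ?T" "distr M borel Y = \<nu>"
      and sq: "integrable M (\<lambda>\<omega>. (norm (X \<omega>))\<^sup>2)" "integrable M (\<lambda>\<omega>. (norm (Y \<omega>))\<^sup>2)"
      and W: "(W2 (distr \<mu> borel ?T) \<nu>)\<^sup>2 = (\<integral>\<omega>. (norm (X \<omega> - Y \<omega>))\<^sup>2 \<partial>M)"
    \<comment> \<open>Undoing the step recovers a variable with law \<open>\<mu>\<close> that
      satisfies \<open>X = ?T Z\<close> pointwise.\<close>
    define Z where "Z \<omega> = S (X \<omega>)" for \<omega>
    have [measurable]: "Z \<in> borel_measurable M"
      unfolding Z_def by measurable
    have X: "X \<omega> = ?T (Z \<omega>)" for \<omega>
      by (simp only: Z_def TS)
    have "?T \<in> borel_measurable \<mu>"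
      unfolding measurable_cong_sets[OF P2_sets[OF \<mu>] refl] by measurable
    have "distr M borel Z = distr (distr M borel X) borel S"
      by (subst distr_distr) (simp_all add: Z_def[abs_def] comp_def)
    also have "\<dots> = distr \<mu> borel (\<lambda>x. S (?T x))"
      unfolding distr(1) using \<open>?T \<in> borel_measurable \<mu>\<close> by (subst distr_distr) (simp_all add: comp_def)
    also have "\<dots> = \<mu>"
      unfolding ST using P2_sets[OF \<mu>] by (simp add: distr_id2)
    finally have Z: "distr M borel Z = \<mu>" .
    have "integrable M (\<lambda>\<omega>. (norm (Z \<omega>))\<^sup>2)"
      using \<mu> M by (simp add: distr_in_P2_iff[symmetric] Z)
    note int = sq this F.integrable_F[OF M _ this] F.integrable_F[OF M _ sq(2)] F.integrable_gradF_sq[OF M _ this]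
    have diff: "integrable M (\<lambda>\<omega>. (norm (Z \<omega> - Y \<omega>))\<^sup>2)" "integrable M (\<lambda>\<omega>. (norm (X \<omega> - Y \<omega>))\<^sup>2)"
      by (intro integrable_norm_sq_diff int; simp)+
    have "(1 - \<tau> * L) * (W2 \<mu> \<nu>)\<^sup>2 + 2 * \<tau> * ((\<integral>x. F x \<partial>\<nu>) - (\<integral>x. F x \<partial>\<mu>)) + \<tau>\<^sup>2 * (\<integral>x. (norm (gradF x))\<^sup>2 \<partial>\<mu>) \<le>
        (1 - \<tau> * L) * (\<integral>\<omega>. (norm (Z \<omega> - Y \<omega>))\<^sup>2 \<partial>M) + 2 * \<tau> * ((\<integral>x. F x \<partial>\<nu>) - (\<integral>x. F x \<partial>\<mu>)) +
        \<tau>\<^sup>2 * (\<integral>x. (norm (gradF x))\<^sup>2 \<partial>\<mu>)"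
      using W2_sq_le[OF M _ _ diff(1)] \<open>\<tau> * L < 1\<close> by (simp add: Z distr mult_left_mono)
    also have "\<dots> = (\<integral>\<omega>. (1 - \<tau> * L) * (norm (Z \<omega> - Y \<omega>))\<^sup>2 + 2 * \<tau> * (F (Y \<omega>) - F (Z \<omega>)) +
        \<tau>\<^sup>2 * (norm (gradF (Z \<omega>)))\<^sup>2 \<partial>M)"
      using int diff unfolding Z[symmetric] distr(2)[symmetric] by (simp add: integral_distr)
    also have "\<dots> \<le> (\<integral>\<omega>. (norm (X \<omega> - Y \<omega>))\<^sup>2 \<partial>M)"
    proof (rule integral_mono[OF _ diff(2)])
      show "integrable M (\<lambda>\<omega>. (1 - \<tau> * L) * (norm (Z \<omega> - Y \<omega>))\<^sup>2 + 2 * \<tau> * (F (Y \<omega>) - F (Z \<omega>)) +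
          \<tau>\<^sup>2 * (norm (gradF (Z \<omega>)))\<^sup>2)"
        using int diff by simp
      fix \<omega>
      have "2 * \<tau> * F (Y \<omega>) \<le> 2 * \<tau> * (F (Z \<omega>) + gradF (Z \<omega>) \<bullet> (Y \<omega> - Z \<omega>) + L / 2 * (norm (Z \<omega> - Y \<omega>))\<^sup>2)"
        using F.quadratic_upper_bound[of "Y \<omega>" "Z \<omega>"] \<open>\<tau> > 0\<close> by (intro mult_left_mono) simp_all
      then show "(1 - \<tau> * L) * (norm (Z \<omega> - Y \<omega>))\<^sup>2 + 2 * \<tau> * (F (Y \<omega>) - F (Z \<omega>)) +
          \<tau>\<^sup>2 * (norm (gradF (Z \<omega>)))\<^sup>2 \<le> (norm (X \<omega> - Y \<omega>))\<^sup>2"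
        unfolding X F.expand_gradient_step by (simp add: algebra_simps)
    qed
    finally show ?thesis
      unfolding W .
  qed
qed

end

section \<open>The one-step inequality for the forward-backward scheme\<close>

theorem lemma4p2:
  fixes F :: "'a::euclidean_space \<Rightarrow> real"
    and gradF :: "'a \<Rightarrow> 'a"
    and H :: "'a measure \<Rightarrow> ereal"
    and L lam \<tau> :: real
    and \<mu> \<nu> :: "'a measure"
  assumes "convex_on UNIV F"
    and "\<And>x. GDERIV F x :> gradF x"
    and "L > 0" and "L-lipschitz_on UNIV gradF"
    and "lam \<ge> 0" and "strongly_convex lam F"
    and "proper_P2 H" and "lsc_W2 H" and "convex_along_gen_geodesics H"
    and "dom_P2 H \<subseteq> P2_ac"
    and "0 < \<tau>" and "\<tau> < 1 / L"
    and "\<mu> \<in> P2" and "\<nu> \<in> P2"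
  shows "ereal ((W2 (fb_step \<tau> gradF H \<mu>) \<nu>)\<^sup>2) \<le>
           ereal ((1 - \<tau> * lam) * (W2 \<mu> \<nu>)\<^sup>2)
           - ereal (2 * \<tau>) * (energy F H (fb_step \<tau> gradF H \<mu>) - energy F H \<nu>)
           - ereal ((1 - \<tau> * L) * (W2 \<mu> (fb_step \<tau> gradF H \<mu>))\<^sup>2)"
proof -
  interpret H: proper_lsc_gen_geodesically_convex H
    using assms by unfold_locales
  have F: "smooth_strongly_convex F gradF L lam"
    using assms by unfold_locales
  have "\<tau> * L < 1"
    using assms(3,12) by (simp add: field_simps)
  define \<rho> where "\<rho> = distr \<mu> borel (\<lambda>x. x - \<tau> *\<^sub>R gradF x)"
  define J where "J = fb_step \<tau> gradF H \<mu>"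
  have J_prox: "J = prox_W2 \<tau> H \<rho>"
    by (simp add: J_def fb_step_def \<rho>_def)
  have \<rho>: "\<rho> \<in> P2"
    unfolding \<rho>_def by (rule smooth_strongly_convex.gradient_step_in_P2[OF F \<open>\<mu> \<in> P2\<close>])
  have J: "J \<in> dom_P2 H"
    unfolding J_prox using H.prox_W2_minimizes(1)[OF \<rho> \<open>0 < \<tau>\<close>] .
  have HJ: "energy F H J = ereal ((\<integral>x. F x \<partial>J) + H.h J)"
    by (simp add: energy_def H.H_eq_h[OF J])
  show ?thesis
  proof (cases "H \<nu> = \<infinity>")
    \<comment> \<open>The energy at \<open>J\<close> is finite, so the energy difference is minus
      infinity and the right side of the claim is plus infinity.\<close>
    case True
    then have "energy F H J - energy F H \<nu> = -\<infinity>"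
      unfolding HJ by (simp add: energy_def)
    then show ?thesis
      using \<open>0 < \<tau>\<close> unfolding J_def[symmetric] by simp
  next
    case False
    then have \<nu>: "\<nu> \<in> dom_P2 H"
      using \<open>\<nu> \<in> P2\<close> by (simp add: dom_P2_def)
    \<comment> \<open>In the combination with the upper bound at \<open>\<nu>\<close> and the lower
      bound at \<open>J\<close>, the squared gradient and the integral of \<open>F\<close> over
      \<open>\<mu>\<close> cancel.\<close>
    have "(W2 J \<nu>)\<^sup>2 \<le> (W2 \<rho> \<nu>)\<^sup>2 - (W2 \<rho> J)\<^sup>2 - 2 * \<tau> * (H.h J - H.h \<nu>)"
      unfolding J_prox using H.prox_W2_EVI[OF \<rho> \<open>0 < \<tau>\<close> \<nu>] .
    moreover note H.W2_gradient_step_upper[OF F \<open>0 < \<tau>\<close> \<open>\<mu> \<in> P2\<close> \<open>\<nu> \<in> P2\<close>, folded \<rho>_def]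
    moreover note H.W2_gradient_step_lower[OF F \<open>0 < \<tau>\<close> \<open>\<tau> * L < 1\<close> \<open>\<mu> \<in> P2\<close> H.dom_imp_P2[OF J], folded \<rho>_def]
    ultimately have "(W2 J \<nu>)\<^sup>2 \<le> (1 - \<tau> * lam) * (W2 \<mu> \<nu>)\<^sup>2
        - 2 * \<tau> * (((\<integral>x. F x \<partial>J) + H.h J) - ((\<integral>x. F x \<partial>\<nu>) + H.h \<nu>)) - (1 - \<tau> * L) * (W2 \<mu> J)\<^sup>2"
      by (simp add: right_diff_distrib distrib_left)
    moreover have "energy F H \<nu> = ereal ((\<integral>x. F x \<partial>\<nu>) + H.h \<nu>)"
      by (simp add: energy_def H.H_eq_h[OF \<nu>])
    ultimately show ?thesis
      unfolding J_def[symmetric] HJ by simp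
  qed
qed

end
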